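(* For every positive integer $w$, the Assouad-Nagata dimension of the class of finite weighted graphs whose underlying graph has tree-width at most $w$ is at most $1$.
   Context: A weighted graph $(G,\phi)$ consists of a simple graph $G$ and $\phi:E(G)\to\mathbb R^+$; it generates the metric space $(V(G),d_{(G,\phi)})$ where $d_{(G,\phi)}(x,y)$ is the infimum over paths $P$ between $x,y$ of $\sum_{e\in E(P)}\phi(e)$. A tree-decomposition of $G$ is a pair $(T,(X_t)_{t\in V(T)})$ with $T$ a tree and $X_t\subseteq V(G)$ such that $\bigcup_t X_t=V(G)$, each edge has both ends in some $X_t$, and for each vertex $v$ the set $\{t:v\in X_t\}$ induces a connected subtree; its width is $\max_t|X_t|-1$, and the tree-width of $G$ is the minimum width. For a class of metric spaces and integer $n\ge0$, $f:\mathbb R^+\to\mathbb R^+$ is a common $n$-dimensional control function if for every member $(X,d)$ and $r>0$ there are collections $\mathcal U_1,\dots,\mathcal U_{n+1}$ of subsets of $X$ covering $X$ with distinct members of the same $\mathcal U_i$ at distance $>r$ pointwise and each member of diameter $\le f(r)$; the Assouad-Nagata dimension is the least $n$ for which such an $f$ with $f(x)\le cx$ (constant $c>0$) exists. *)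

theory Defs
  imports
    "Graph_Theory.Graph_Theory"
    "HOL-Library.Extended_Real"
    "HOL-Library.Extended_Nat"
begin

text \<open>
  A simple graph, possibly infinite, is a loop-free symmetric digraph without parallel arcs:
  an undirected edge is represented by a pair of opposite arcs.
\<close>

abbreviation simple_graph :: "'a pair_pre_digraph \<Rightarrow> bool" where
  "simple_graph G \<equiv> pair_bidirected_digraph G"

text \<open>
  The weight is a function of the undirected edge, so opposite arcs have the same weight.
\<close>

definition weighted_graph :: "'a pair_pre_digraph \<Rightarrow> ('a \<times> 'a \<Rightarrow> real) \<Rightarrow> bool" where
  "weighted_graph G \<phi> \<longleftrightarrow>
     simple_graph G \<and>
     (\<forall>(u, v) \<in> parcs G. 0 < \<phi> (u, v) \<and> \<phi> (v, u) = \<phi> (u, v))"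

text \<open>
  A path has distinct vertices, so the sum over its list of arcs counts each of its edges once.
  The distance between vertices in different components is \<open>\<infinity>\<close>, the infimum of the
  empty set.
\<close>

definition graph_dist :: "'a pair_pre_digraph \<Rightarrow> ('a \<times> 'a \<Rightarrow> real) \<Rightarrow> 'a \<Rightarrow> 'a \<Rightarrow> ereal" where
  "graph_dist G \<phi> x y =
     (INF p \<in> {p. pre_digraph.apath (with_proj G) x p y}. ereal (\<Sum>e\<leftarrow>p. \<phi> e))"

text \<open>
  The notion \<^const>\<open>tree\<close> of the library does not fit symmetric digraphs, where an
  edge traversed back and forth already counts as a cycle. In a loop-free symmetric digraph the
  cycles of the underlying undirected graph are those of length at least 3.
\<close>

definition is_tree :: "'t pair_pre_digraph \<Rightarrow> bool" where
  "is_tree T \<longleftrightarrow>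
     simple_graph T \<and> connected (with_proj T) \<and>
     (\<nexists>c. pre_digraph.cycle (with_proj T) c \<and> 3 \<le> length c)"

definition tree_decomposition ::
    "'a pair_pre_digraph \<Rightarrow> 't pair_pre_digraph \<Rightarrow> ('t \<Rightarrow> 'a set) \<Rightarrow> bool" where
  "tree_decomposition G T X \<longleftrightarrow>
     is_tree T \<and>
     (\<forall>t \<in> pverts T. X t \<subseteq> pverts G) \<and>
     (\<Union>t \<in> pverts T. X t) = pverts G \<and>
     (\<forall>(u, v) \<in> parcs G. \<exists>t \<in> pverts T. u \<in> X t \<and> v \<in> X t) \<and>
     (\<forall>v \<in> pverts G. connected (with_proj T \<restriction> {t \<in> pverts T. v \<in> X t}))"

text \<open>
  Width and tree-width are meant for finite graphs. They are integers because the null graph has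
  tree-width -1. The decomposition tree may be infinite; nodes in \<^typ>\<open>nat\<close> suffice,
  since every tree-decomposition of a finite graph restricts to a finite subtree. The infimum is
  a minimum, being taken over a nonempty set of integers bounded below by -1.
\<close>

definition td_width :: "'t pair_pre_digraph \<Rightarrow> ('t \<Rightarrow> 'a set) \<Rightarrow> int" where
  "td_width T X = (MAX t \<in> pverts T. int (card (X t))) - 1"

definition tree_width :: "'a pair_pre_digraph \<Rightarrow> int" where
  "tree_width G =
     Inf {td_width T X | (T :: nat pair_pre_digraph) X. tree_decomposition G T X}"

definition diam :: "('a \<Rightarrow> 'a \<Rightarrow> ereal) \<Rightarrow> 'a set \<Rightarrow> ereal" where
  "diam d A = (SUP x \<in> A. SUP y \<in> A. d x y)"

text \<open>
  A metric space is a pair of a carrier set and a distance function, and a class of metric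
  spaces is a set of such pairs. Here \<open>\<real>\<^sup>+\<close> is the set of positive reals, so the values of
  a control function outside the positive reals are irrelevant.
\<close>

definition common_control_function ::
    "nat \<Rightarrow> ('a set \<times> ('a \<Rightarrow> 'a \<Rightarrow> ereal)) set \<Rightarrow> (real \<Rightarrow> real) \<Rightarrow> bool" where
  "common_control_function n \<C> f \<longleftrightarrow>
     (\<forall>x > 0. f x > 0) \<and>
     (\<forall>(X, d) \<in> \<C>. \<forall>r > 0. \<exists>\<U> :: nat \<Rightarrow> 'a set set.
        (\<forall>i \<in> {1..n+1}. \<forall>A \<in> \<U> i. A \<subseteq> X) \<and>
        (\<Union>i \<in> {1..n+1}. \<Union>(\<U> i)) = X \<and>
        (\<forall>i \<in> {1..n+1}. \<forall>A \<in> \<U> i. \<forall>B \<in> \<U> i. A \<noteq> B \<longrightarrow>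
           (\<forall>a \<in> A. \<forall>b \<in> B. d a b > ereal r)) \<and>
        (\<forall>i \<in> {1..n+1}. \<forall>A \<in> \<U> i. diam d A \<le> ereal (f r)))"

text \<open>
  The dimension is \<open>\<infinity>\<close> if there is no suitable \<open>n\<close>.
\<close>

definition assouad_nagata_dim :: "('a set \<times> ('a \<Rightarrow> 'a \<Rightarrow> ereal)) set \<Rightarrow> enat" where
  "assouad_nagata_dim \<C> =
     Inf {enat n | n. \<exists>f. common_control_function n \<C> f \<and> (\<exists>c > 0. \<forall>x > 0. f x \<le> c * x)}"

end

theory Submission
  imports Defs
begin

text \<open>
  At a fixed scale \<open>r\<close>, a 2-colouring with bounded monochromatic \<open>r\<close>-components is
  built by induction on the bag size. Around the root bag \<open>S\<close> two concentric rings of width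
  \<open>r\<close> get opposite colours, so no component passes from \<open>S\<close> beyond distance \<open>3r\<close>. Cut the
  decomposition tree at the topmost bags missing the ball \<open>B\<close> of radius \<open>3r\<close> around \<open>S\<close>. Above the
  cut every bag loses a vertex to \<open>B\<close>, so induction colours that part, at a larger scale \<open>r'\<close>.
  Below the cut one recurses on smaller trees, where the points near an adhesion set copy colours
  from above. A component entering a lower part stays near its root bag, so moving its points to the
  adhesion set yields a monochromatic \<open>r'\<close>-connected set above the cut, up to points close to \<open>S\<close>,
  and a set that is connected at scale \<open>r'\<close> and close to the few points of \<open>S\<close> is bounded.
  The bounds do not depend on the weights, so rescaling the metric gives linear control.
\<close>

section \<open>Connectedness at a given scale\<close>

text \<open>\<open>D s x y\<close> says that the distance is at most \<open>s\<close>; a relation also covers infinite distances.\<close>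

locale coarse =
  fixes D :: "real \<Rightarrow> 'v \<Rightarrow> 'v \<Rightarrow> bool"
  assumes refl: "D 0 x x"
    and sym: "D s x y \<Longrightarrow> D s y x"
    and triangle: "D s x y \<Longrightarrow> D t y z \<Longrightarrow> D (s + t) x z"
    and mono: "D s x y \<Longrightarrow> s \<le> t \<Longrightarrow> D t x y"
begin

definition near :: "real \<Rightarrow> 'v set \<Rightarrow> 'v set" where
  "near s A = {x. \<exists>a\<in>A. D s x a}"

text \<open>Being a reflexive closure, it also relates a point outside \<open>Q\<close> to itself;
  hence the membership assumption in \<open>linked_in\<close>.\<close>

definition linked :: "real \<Rightarrow> 'v set \<Rightarrow> 'v \<Rightarrow> 'v \<Rightarrow> bool" where
  "linked r Q = (\<lambda>x y. x \<in> Q \<and> y \<in> Q \<and> D r x y)\<^sup>*\<^sup>*"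

definition rconn :: "real \<Rightarrow> 'v set \<Rightarrow> bool" where
  "rconn r Q \<longleftrightarrow> (\<forall>x\<in>Q. \<forall>y\<in>Q. linked r Q x y)"

lemma nearI: "a \<in> A \<Longrightarrow> D s x a \<Longrightarrow> x \<in> near s A"
  by (auto simp: near_def)

lemma near_trans: "y \<in> near s A \<Longrightarrow> D t x y \<Longrightarrow> t + s \<le> u \<Longrightarrow> x \<in> near u A"
  unfolding near_def using triangle mono by blast

lemma near_mono: "x \<in> near s A \<Longrightarrow> s \<le> u \<Longrightarrow> x \<in> near u A"
  unfolding near_def using mono by blast

lemma linked_refl: "linked r Q x x"
  by (simp add: linked_def)

lemma linked_sym: "linked r Q x y \<Longrightarrow> linked r Q y x"
  unfolding linked_def
  by (metis (mono_tags, lifting) sym symp_on_def symp_rtranclp sympD)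

lemma linked_trans: "linked r Q x y \<Longrightarrow> linked r Q y z \<Longrightarrow> linked r Q x z"
  unfolding linked_def by (rule rtranclp_trans)

lemma linked_step: "x \<in> Q \<Longrightarrow> y \<in> Q \<Longrightarrow> D r x y \<Longrightarrow> linked r Q x y"
  unfolding linked_def by blast

lemma linked_in: "linked r Q x y \<Longrightarrow> x \<in> Q \<Longrightarrow> y \<in> Q"
  unfolding linked_def by (induction rule: rtranclp_induct) auto

text \<open>The first step of the chain that leaves \<open>A\<close> gives \<open>u\<close> and
  \<open>v\<close>; everything before it stays in \<open>Q \<inter> A\<close>.\<close>

lemma linked_exit:
  assumes "linked r Q x y" "x \<in> Q" "x \<in> A" "y \<notin> A"
  shows "\<exists>u v. linked r (Q \<inter> A) x u \<and> u \<in> Q \<inter> A \<and> v \<in> Q - A \<and> D r u v"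
proof -
  have "(y \<in> A \<and> linked r (Q \<inter> A) x y) \<or>
    (\<exists>u v. linked r (Q \<inter> A) x u \<and> u \<in> Q \<inter> A \<and> v \<in> Q - A \<and> D r u v)"
    using assms(1) unfolding linked_def[of r Q]
  proof (induction rule: rtranclp_induct)
    case base
    then show ?case using assms by (simp add: linked_refl)
  next
    case (step y z)
    show ?case
    proof (cases "y \<in> A \<and> linked r (Q \<inter> A) x y")
      case True
      then show ?thesis using step.hyps(2) linked_trans[OF _ linked_step] by blast
    next
      case False
      then show ?thesis using step.IH by blast
    qed
  qed
  with assms(4) show ?thesis by blast
qed

lemma rconn_exit:
  assumes "rconn r Q" "x \<in> Q" "x \<in> A" "\<not> Q \<subseteq> A"
  shows "\<exists>u v. linked r (Q \<inter> A) x u \<and> u \<in> Q \<inter> A \<and> v \<in> Q - A \<and> D r u v"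
  using assms linked_exit unfolding rconn_def by blast

text \<open>Every chain from \<open>x\<close> in \<open>Q\<close> stays in the class of
  \<open>x\<close>, so the class is connected within itself and not merely within
  \<open>Q\<close>.\<close>

lemma rconn_component: "rconn r {y. linked r Q x y}"
proof -
  have *: "linked r {y. linked r Q x y} x y" if "linked r Q x y" for y
    using that unfolding linked_def[of r Q]
  proof (induction rule: rtranclp_induct)
    case base
    then show ?case by (simp add: linked_refl)
  next
    case (step y z)
    then show ?case
      by (smt (verit) linked_def linked_step linked_trans mem_Collect_eq rtranclp.rtrancl_into_rtrancl)
  qed
  then show ?thesis unfolding rconn_def
    using linked_sym linked_trans by blast
qed

text \<open>Each point of \<open>S\<close> costs at most one ball diameter \<open>2 * s\<close> and
  one step \<open>r\<close>; the induction removes a point \<open>a\<close> whose ball contains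
  \<open>p\<close>.\<close>

lemma linked_near_finite:
  assumes "finite S" "linked r Q p q" "p \<in> Q" "Q \<subseteq> near s S" "0 \<le> r" "0 \<le> s"
  shows "D (real (card S) * (2 * s + r)) p q"
  using assms(1-4)
proof (induction "card S" arbitrary: S Q p q)
  case 0
  then show ?case by (auto simp: near_def)
next
  case (Suc n)
  from Suc.prems obtain a where a: "a \<in> S" "D s p a" unfolding near_def by blast
  have eq: "real (card S) * (2 * s + r) = real (card (S - {a})) * (2 * s + r) + r + 2 * s"
    using card_Suc_Diff1[OF Suc.prems(1) a(1)] by (simp add: algebra_simps flip: Suc.hyps(2))
  have ge: "0 \<le> real (card (S - {a})) * (2 * s + r)" using assms by simp
  show ?case
  proof (cases "D s q a")
    case True
    then have "D (s + s) p q" using a triangle sym by blast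
    then show ?thesis using eq ge assms by (auto intro: mono)
  next
    case False
    \<comment> \<open>Followed from \<open>q\<close>, the chain enters the ball of \<open>a\<close>
      for the first time by a step from \<open>v\<close> to \<open>u\<close>; up to \<open>v\<close>
      it only uses balls of \<open>S - {a}\<close>.\<close>
    obtain v u where vu: "linked r (Q \<inter> {x. \<not> D s x a}) q v" "v \<in> Q" "\<not> D s v a" "u \<in> Q"
      "D s u a" "D r v u"
      using linked_exit[OF linked_sym[OF Suc.prems(2)], of "{x. \<not> D s x a}"] False a
        linked_in[OF Suc.prems(2,3)] by auto
    have "D (real (card (S - {a})) * (2 * s + r)) q v"
    proof (rule Suc.hyps(1)[OF _ _ vu(1)])
      show "n = card (S - {a})" using Suc.hyps(2) a(1) by (simp add: card_Diff_singleton_if)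
      show "q \<in> Q \<inter> {x. \<not> D s x a}" using False linked_in[OF Suc.prems(2,3)] by auto
      show "Q \<inter> {x. \<not> D s x a} \<subseteq> near s (S - {a})" using Suc.prems(4) by (auto simp: near_def)
    qed (use Suc.prems in auto)
    then have "D (real (card (S - {a})) * (2 * s + r) + r) q u" using vu triangle by blast
    moreover have "D (s + s) u p" using vu a triangle sym by blast
    ultimately have "D (real (card (S - {a})) * (2 * s + r) + r + (s + s)) q p" by (rule triangle)
    then show ?thesis using sym eq by simp
  qed
qed

end

section \<open>Tree-like spaces\<close>

datatype 'v rtree = Node (bag: "'v set") (kids: "'v rtree list")

fun verts_of :: "'v rtree \<Rightarrow> 'v set" where
  "verts_of (Node X ks) = X \<union> (\<Union>k\<in>set ks. verts_of k)"

fun bags :: "'v rtree \<Rightarrow> 'v set set" where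
  "bags (Node X ks) = insert X (\<Union>k\<in>set ks. bags k)"

text \<open>
  \<open>prune B\<close> keeps the connected part of the tree that contains the root and whose other bags all
  meet \<open>B\<close>; \<open>cuts B\<close> collects the subtrees hanging below it.
\<close>

fun prune :: "'v set \<Rightarrow> 'v rtree \<Rightarrow> 'v rtree" where
  "prune B (Node X ks) = Node X (map (prune B) (filter (\<lambda>k. bag k \<inter> B \<noteq> {}) ks))"

fun cuts :: "'v set \<Rightarrow> 'v rtree \<Rightarrow> 'v rtree set" where
  "cuts B (Node X ks) = {k \<in> set ks. bag k \<inter> B = {}} \<union>
     (\<Union>k \<in> {k \<in> set ks. bag k \<inter> B \<noteq> {}}. cuts B k)"

lemma verts_of_bags: "verts_of t = \<Union> (bags t)"
  by (induction t) auto

lemma bag_prune [simp]: "bag (prune B t) = bag t"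
  by (cases t) auto

lemma bag_subset_verts: "bag t \<subseteq> verts_of t"
  by (cases t) auto

lemma bag_in_bags: "bag t \<in> bags t"
  by (cases t) auto

lemma verts_prune_subset: "verts_of (prune B t) \<subseteq> verts_of t"
  by (induction t) fastforce

lemma bags_prune: "bags (prune B t) \<subseteq> insert (bag t) {Y \<in> bags t. Y \<inter> B \<noteq> {}}"
  by (induction t) (fastforce simp: bag_in_bags)

lemma verts_cuts_subset: "f \<in> cuts B t \<Longrightarrow> verts_of f \<subseteq> verts_of t"
  by (induction t) fastforce

lemma bags_cuts_subset: "f \<in> cuts B t \<Longrightarrow> bags f \<subseteq> bags t"
  by (induction t) fastforce

lemma bag_cuts: "f \<in> cuts B t \<Longrightarrow> bag f \<inter> B = {}"
  by (induction t) fastforce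

lemma size_cuts: "f \<in> cuts B t \<Longrightarrow> size f < size t"
proof (induction t)
  case (Node X ks)
  then obtain k where k: "k \<in> set ks" "f = k \<or> f \<in> cuts B k" by auto
  with Node.IH have "size f \<le> size k" by (auto intro: less_imp_le)
  also have "size k < size (Node X ks)" using size_list_estimation'[OF k(1), of "size k" size] by simp
  finally show ?case .
qed

lemma verts_prune_cuts: "verts_of t \<subseteq> verts_of (prune B t) \<union> (\<Union>f\<in>cuts B t. verts_of f)"
proof (induction t)
  case (Node X ks)
  show ?case
  proof
    fix x assume "x \<in> verts_of (Node X ks)"
    then consider "x \<in> X" | k where "k \<in> set ks" "x \<in> verts_of k" by auto
    then show "x \<in> verts_of (prune B (Node X ks)) \<union> (\<Union>f\<in>cuts B (Node X ks). verts_of f)"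
      by cases (use Node.IH in fastforce)+
  qed
qed

section \<open>Separation by adhesion sets\<close>

context coarse
begin

text \<open>The distance splits at a point of \<open>A\<close> without loss, which lets separations
  be composed. Nonnegativity of the parts bounds each of them by \<open>s\<close>.\<close>

definition separates :: "'v set \<Rightarrow> 'v set \<Rightarrow> 'v set \<Rightarrow> bool" where
  "separates A P Q \<longleftrightarrow> P \<inter> Q \<subseteq> A \<and>
     (\<forall>p\<in>P. \<forall>q\<in>Q. \<forall>s. D s p q \<longrightarrow> (\<exists>a\<in>A. \<exists>s1 s2. s1 + s2 \<le> s \<and> 0 \<le> s1 \<and> 0 \<le> s2 \<and> D s1 p a \<and> D s2 a q))"

lemma separates_mono:
  "separates A P Q \<Longrightarrow> A \<subseteq> A' \<Longrightarrow> P' \<subseteq> P \<Longrightarrow> Q' \<subseteq> Q \<Longrightarrow> separates A' P' Q'"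
  unfolding separates_def by blast

lemma separatesD:
  assumes "separates A P Q" "p \<in> P" "q \<in> Q" "D s p q"
  shows "\<exists>a\<in>A. D s p a \<and> D s a q"
proof -
  obtain a s1 s2 where "a \<in> A" "s1 + s2 \<le> s" "0 \<le> s1" "0 \<le> s2" "D s1 p a" "D s2 a q"
    using assms unfolding separates_def by blast
  then show ?thesis using mono[of s1 p a s] mono[of s2 a q s] by auto
qed

text \<open>Only distances and vertex sets occur, no edges, so pruning and cutting preserve the
  property while \<open>D\<close> stays fixed.\<close>

fun tree_like :: "'v rtree \<Rightarrow> bool" where
  "tree_like (Node X ks) \<longleftrightarrow> (\<forall>k\<in>set ks. tree_like k \<and>
     separates (X \<inter> bag k) (verts_of k) (X \<union> (\<Union>k'\<in>set ks - {k}. verts_of k')))"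

lemma tree_like_prune: "tree_like t \<Longrightarrow> tree_like (prune B t)"
proof (induction t)
  case (Node X ks)
  have "separates (X \<inter> bag (prune B k)) (verts_of (prune B k))
      (X \<union> (\<Union>k'\<in>set (map (prune B) (filter (\<lambda>k. bag k \<inter> B \<noteq> {}) ks)) - {prune B k}. verts_of k'))"
    if "k \<in> set ks" for k
  proof (rule separates_mono)
    show "separates (X \<inter> bag k) (verts_of k) (X \<union> (\<Union>k'\<in>set ks - {k}. verts_of k'))"
      using Node.prems that by simp
    show "X \<union> (\<Union>k'\<in>set (map (prune B) (filter (\<lambda>k. bag k \<inter> B \<noteq> {}) ks)) - {prune B k}. verts_of k')
      \<subseteq> X \<union> (\<Union>k'\<in>set ks - {k}. verts_of k')"
      using verts_prune_subset by fastforce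
  qed (auto simp: verts_prune_subset)
  then show ?case using Node by simp
qed

lemma tree_like_cuts: "tree_like t \<Longrightarrow> f \<in> cuts B t \<Longrightarrow> tree_like f"
  by (induction t) auto

text \<open>A route from \<open>P\<close> to \<open>Q'\<close> meets \<open>A'\<close>, and its part
  up to there, ending in \<open>Q\<close>, meets \<open>A\<close>; the remaining lengths add up by
  the triangle inequality.\<close>

lemma separates_trans:
  assumes "separates A P Q" "separates A' P' Q'" "P \<subseteq> P'" "A' \<subseteq> Q"
  shows "separates A P (Q \<union> Q')"
  unfolding separates_def
proof (intro conjI ballI allI impI)
  show "P \<inter> (Q \<union> Q') \<subseteq> A" using assms unfolding separates_def by blast
next
  fix p q s assume p: "p \<in> P" and q: "q \<in> Q \<union> Q'" and d: "D s p q"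
  show "\<exists>a\<in>A. \<exists>s1 s2. s1 + s2 \<le> s \<and> 0 \<le> s1 \<and> 0 \<le> s2 \<and> D s1 p a \<and> D s2 a q"
  proof (cases "q \<in> Q")
    case True
    then show ?thesis using assms(1) p d unfolding separates_def by blast
  next
    case False
    then obtain a' s1 s2 where a': "a' \<in> A'" "s1 + s2 \<le> s" "0 \<le> s1" "0 \<le> s2" "D s1 p a'" "D s2 a' q"
      using assms(2,3) p q d unfolding separates_def by blast
    then obtain a u1 u2 where a: "a \<in> A" "u1 + u2 \<le> s1" "0 \<le> u1" "0 \<le> u2" "D u1 p a" "D u2 a a'"
      using assms(1,4) p unfolding separates_def by blast
    have "D (u2 + s2) a q" using a a' triangle by blast
    moreover have "u1 + (u2 + s2) \<le> s" "0 \<le> u2 + s2" using a a' by auto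
    ultimately show ?thesis using a by blast
  qed
qed

text \<open>For \<open>f\<close> directly below the root this weakens \<open>tree_like\<close>.
  Below a kept child \<open>k\<close> the induction hypothesis reaches as far as \<open>k\<close>,
  and \<open>separates_trans\<close> carries it across the adhesion set of \<open>k\<close> to the
  rest.\<close>

lemma separates_cuts:
  assumes "tree_like t" "f \<in> cuts B t"
  shows "separates (bag f \<inter> verts_of (prune B t)) (verts_of f)
    (verts_of (prune B t) \<union> (\<Union>g\<in>cuts B t - {f}. verts_of g))"
  using assms
proof (induction t)
  case (Node X ks)
  let ?t = "Node X ks"
  define rest where "rest k = X \<union> (\<Union>k'\<in>set ks - {k}. verts_of k')" for k
  have sepk: "separates (X \<inter> bag k) (verts_of k) (rest k)" if "k \<in> set ks" for k
    using Node.prems(1) that by (auto simp: rest_def)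
  show ?case
  proof (cases "f \<in> set ks \<and> bag f \<inter> B = {}")
    case True
    have "verts_of (prune B ?t) \<union> (\<Union>g\<in>cuts B ?t - {f}. verts_of g) \<subseteq> rest f"
      unfolding rest_def using True verts_prune_subset[of B] verts_cuts_subset[of _ B] by fastforce
    moreover have "X \<inter> bag f \<subseteq> bag f \<inter> verts_of (prune B ?t)" by auto
    ultimately show ?thesis using separates_mono[OF sepk[of f] _ subset_refl] True by blast
  next
    case False
    then obtain k where k: "k \<in> set ks" "bag k \<inter> B \<noteq> {}" "f \<in> cuts B k" using Node.prems(2) by auto
    let ?in = "verts_of (prune B k) \<union> (\<Union>g\<in>cuts B k - {f}. verts_of g)"
    have "separates (bag f \<inter> verts_of (prune B k)) (verts_of f) (?in \<union> rest k)"
    proof (rule separates_trans)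
      show "separates (bag f \<inter> verts_of (prune B k)) (verts_of f) ?in"
        using Node k by auto
      show "separates (X \<inter> bag k) (verts_of k) (rest k)" using sepk k by blast
      show "verts_of f \<subseteq> verts_of k" using k verts_cuts_subset by blast
      show "X \<inter> bag k \<subseteq> ?in" using bag_subset_verts[of "prune B k"] by auto
    qed
    then show ?thesis
    proof (rule separates_mono)
      show "bag f \<inter> verts_of (prune B k) \<subseteq> bag f \<inter> verts_of (prune B ?t)" using k by auto
      show "verts_of (prune B ?t) \<union> (\<Union>g\<in>cuts B ?t - {f}. verts_of g) \<subseteq> ?in \<union> rest k"
      proof
        have out: "verts_of k' \<subseteq> rest k" if "k' \<in> set ks" "k' \<noteq> k" for k'
          using that by (auto simp: rest_def)
        fix x assume "x \<in> verts_of (prune B ?t) \<union> (\<Union>g\<in>cuts B ?t - {f}. verts_of g)"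
        then consider "x \<in> X" | k' where "k' \<in> set ks" "x \<in> verts_of (prune B k')"
          | k' where "k' \<in> set ks" "bag k' \<inter> B = {}" "x \<in> verts_of k'"
          | k' g where "k' \<in> set ks" "g \<in> cuts B k'" "g \<noteq> f" "x \<in> verts_of g"
          by auto
        then show "x \<in> ?in \<union> rest k"
        proof cases
          case 1
          then show ?thesis by (simp add: rest_def)
        next
          case 2
          then show ?thesis using out[of k'] subsetD[OF verts_prune_subset 2(2)] by (cases "k' = k") auto
        next
          case 3
          then show ?thesis using out[of k'] k(2) by (cases "k' = k") auto
        next
          case 4
          then show ?thesis using out[of k'] verts_cuts_subset[OF 4(2)] by (cases "k' = k") auto
        qed
      qed
    qed simp
  qed
qed

end

section \<open>Colouring tree-like spaces\<close>

context coarse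
begin

definition bounded_by :: "real \<Rightarrow> 'v set \<Rightarrow> bool" where
  "bounded_by C Q \<longleftrightarrow> (\<forall>x\<in>Q. \<forall>y\<in>Q. D C x y)"

text \<open>All connected monochromatic sets are taken, not only maximal ones, so that a connected
  piece of a cluster is again a cluster.\<close>

definition clusters :: "('v \<Rightarrow> bool) \<Rightarrow> real \<Rightarrow> 'v set \<Rightarrow> 'v set set" where
  "clusters c r V = {Q. Q \<subseteq> V \<and> rconn r Q \<and> (\<exists>\<kappa>. \<forall>x\<in>Q. c x = \<kappa>)}"

text \<open>
  The vertices of the hole \<open>Z\<close> do not count for the size of a bag. Enlarging the hole replaces
  deleting vertices, so that the metric never changes during the induction.
\<close>

definition controlled :: "nat \<Rightarrow> real \<Rightarrow> real \<Rightarrow> real \<Rightarrow> bool" where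
  "controlled j r C \<rho> \<longleftrightarrow> (\<forall>t Z. tree_like t \<longrightarrow> (\<forall>Y\<in>bags t. finite (Y - Z) \<and> card (Y - Z) \<le> j) \<longrightarrow>
     (\<exists>c. \<forall>Q\<in>clusters c r (verts_of t - near \<rho> Z). bounded_by C Q))"

lemma bounded_by_mono: "bounded_by C Q \<Longrightarrow> C \<le> C' \<Longrightarrow> bounded_by C' Q"
  unfolding bounded_by_def using mono by blast

lemma near_self: "0 \<le> s \<Longrightarrow> A \<subseteq> near s A"
  unfolding near_def using refl mono by blast

text \<open>With no counted vertices every bag lies in the hole, and nothing remains to be
  coloured.\<close>

lemma controlled_0:
  assumes "0 \<le> \<rho>" shows "controlled 0 r C \<rho>"
  unfolding controlled_def
proof (intro allI impI exI ballI)
  fix t Z c Q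
  assume small: "\<forall>Y\<in>bags t. finite (Y - Z) \<and> card (Y - Z) \<le> 0"
    and Q: "Q \<in> clusters c r (verts_of t - near \<rho> Z)"
  have "Y \<subseteq> Z" if "Y \<in> bags t" for Y
    using small that by (metis Diff_eq_empty_iff card_0_eq le_zero_eq)
  then have "verts_of t \<subseteq> Z" by (auto simp: verts_of_bags)
  then have "Q = {}" using Q near_self[OF assms] unfolding clusters_def by blast
  then show "bounded_by C Q" by (simp add: bounded_by_def)
qed

lemma clusters_component:
  assumes "Q \<subseteq> V" "\<forall>x\<in>Q. c x = \<kappa>" "x \<in> Q"
  shows "{y. linked r Q x y} \<in> clusters c r V"
proof -
  have "{y. linked r Q x y} \<subseteq> Q" using linked_in[OF _ assms(3)] by auto
  then show ?thesis using assms(1,2) rconn_component unfolding clusters_def by blast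
qed

lemma linked_image:
  assumes "linked r Q x y" "\<And>x y. x \<in> Q \<Longrightarrow> y \<in> Q \<Longrightarrow> D r x y \<Longrightarrow> D r' (g x) (g y)"
  shows "linked r' (g ` Q) (g x) (g y)"
  using assms(1) unfolding linked_def[of r Q]
proof (induction rule: rtranclp_induct)
  case base
  then show ?case by (rule linked_refl)
next
  case (step y z)
  then have "linked r' (g ` Q) (g y) (g z)" by (intro linked_step assms(2)) auto
  with step.IH show ?case by (rule linked_trans)
qed

lemma bounded_by_near_finite:
  assumes "finite S" "card S \<le> n" "rconn r Q" "Q \<subseteq> near s S" "0 \<le> r" "0 \<le> s"
  shows "bounded_by (real n * (2 * s + r)) Q"
proof -
  have "D (real n * (2 * s + r)) p q" if "p \<in> Q" "q \<in> Q" for p q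
  proof (rule mono)
    show "D (real (card S) * (2 * s + r)) p q"
      using linked_near_finite assms that unfolding rconn_def by blast
    show "real (card S) * (2 * s + r) \<le> real n * (2 * s + r)"
      using assms by (intro mult_right_mono) auto
  qed
  then show ?thesis by (simp add: bounded_by_def)
qed

text \<open>\<open>M\<close> bounds the piece, inside a cut subtree, of a cluster that leaves it: at
  most \<open>Suc j\<close> balls of radius \<open>3 * r\<close>. Moving points by
  \<open>M + r\<close> turns scale \<open>r\<close> into \<open>r'\<close>, and
  \<open>\<rho>\<close> exceeds \<open>\<rho>'\<close> by the same shift. \<open>L\<close> sums an
  inner cluster, one step of length \<open>r'\<close>, the margin \<open>\<rho>'\<close> and the
  radius \<open>3 * r\<close> of \<open>B\<close>. \<open>C\<close> adds the shifts of both ends to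
  the bounds of the two final cases.\<close>

lemma controlled_Suc:
  fixes r C' \<rho>' :: real and j :: nat
  defines "M \<equiv> real (Suc j) * (7 * r)"
  defines "r' \<equiv> 2 * M + 3 * r"
  defines "L \<equiv> C' + r' + \<rho>' + 3 * r"
  defines "C \<equiv> 2 * (M + r) + real (Suc j) * (2 * L + r') + C'"
  defines "\<rho> \<equiv> \<rho>' + M + r"
  assumes inner: "controlled j r' C' \<rho>'" and pos: "0 < r" "0 \<le> C'" "0 \<le> \<rho>'"
  shows "controlled (Suc j) r C \<rho>"
proof -
  have "7 * r \<le> M" unfolding M_def using pos by (simp add: algebra_simps)
  then have const: "7 * r \<le> M" "0 \<le> r'" "0 \<le> L" "0 \<le> \<rho>" "3 * r \<le> \<rho>" "r \<le> \<rho>" "0 \<le> 2 * L + r'"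
    using pos by (auto simp: r'_def L_def \<rho>_def)
  have constC: "0 \<le> real (Suc j) * (2 * L + r')" using const by simp
  \<comment> \<open>Strengthening for the inner induction on tree size: colours near the root bag
    are prescribed, so that a cut subtree can be fitted to colours from above, and clusters meeting
    that neighbourhood stay close to the root bag.\<close>
  have ext: "\<exists>c. (\<forall>x \<in> near r (bag t - Z) - near \<rho> Z. c x = c0 x) \<and>
      (\<forall>Q \<in> clusters c r (verts_of t - near \<rho> Z). bounded_by C Q \<and>
         (Q \<inter> near r (bag t - Z) \<noteq> {} \<longrightarrow> Q \<subseteq> near (3 * r) (bag t - Z)))"
    if "tree_like t" "\<forall>Y\<in>bags t. finite (Y - Z) \<and> card (Y - Z) \<le> Suc j" for t Z and c0 :: "'v \<Rightarrow> bool"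
    using that
  proof (induction t arbitrary: c0 rule: measure_induct_rule[of size])
    case (less t)
    define S where "S = bag t - Z"
    \<comment> \<open>Removing \<open>Z\<close> ensures that a bag meeting \<open>B\<close> loses a
      vertex that was counted.\<close>
    define B where "B = near (3 * r) S - Z"
    define P where "P = verts_of (prune B t)"
    have finS: "finite S" "card S \<le> Suc j"
      using less.prems(2) bag_in_bags[of t] by (auto simp: S_def)
    have S_B: "S \<subseteq> B" using near_self[of "3 * r" S] pos by (auto simp: B_def S_def)
    have S_P: "S \<subseteq> P" using bag_subset_verts[of "prune B t"] by (auto simp: S_def P_def)
    have sep: "separates (bag f \<inter> P) (verts_of f) (P \<union> (\<Union>g\<in>cuts B t - {f}. verts_of g))"
      if "f \<in> cuts B t" for f
      using separates_cuts[OF less.prems(1) that] by (simp add: P_def)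
    have notZ: "x \<notin> Z" if "x \<notin> near \<rho> Z" for x
      using that near_self[of \<rho> Z] const by blast
    \<comment> \<open>The outer hypothesis applies to the pruned tree with hole
      \<open>Z \<union> B\<close>: the root bag lies entirely in the hole, and every other bag meets
      \<open>B\<close> and so has at most \<open>j\<close> counted vertices left.\<close>
    obtain cH where cH: "\<And>Q. Q \<in> clusters cH r' (P - near \<rho>' (Z \<union> B)) \<Longrightarrow> bounded_by C' Q"
    proof -
      have "finite (Y - (Z \<union> B)) \<and> card (Y - (Z \<union> B)) \<le> j" if "Y \<in> bags (prune B t)" for Y
      proof (cases "Y = bag t")
        case True
        then have empty: "Y - (Z \<union> B) = {}" using S_B by (auto simp: S_def)
        show ?thesis unfolding empty by simp
      next
        case False
        then have Y: "Y \<in> bags t" "Y \<inter> B \<noteq> {}" using bags_prune that by blast+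
        then have sub: "Y - (Z \<union> B) \<subset> Y - Z" by (auto simp: B_def)
        have fin: "finite (Y - Z)" "card (Y - Z) \<le> Suc j" using less.prems(2) Y(1) by auto
        have "finite (Y - (Z \<union> B))" using sub fin finite_subset by blast
        moreover have "card (Y - (Z \<union> B)) < card (Y - Z)" using sub fin(1) by (rule psubset_card_mono[rotated])
        ultimately show ?thesis using fin by simp
      qed
      then show ?thesis
        using inner tree_like_prune[OF less.prems(1)] that unfolding controlled_def P_def by blast
    qed
    \<comment> \<open>The colour of an arbitrary close adhesion point will do; it need not be a nearest one.\<close>
    define c0f where "c0f f x = (if x \<in> P then cH x else cH (SOME a. a \<in> bag f \<inter> P \<and> D r x a))" for f x
    have "\<exists>c. (\<forall>x \<in> near r (bag f - Z) - near \<rho> Z. c x = c0f f x) \<and>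
      (\<forall>Q \<in> clusters c r (verts_of f - near \<rho> Z). bounded_by C Q \<and>
         (Q \<inter> near r (bag f - Z) \<noteq> {} \<longrightarrow> Q \<subseteq> near (3 * r) (bag f - Z)))" if "f \<in> cuts B t" for f
    proof (rule less.IH[OF size_cuts[OF that] tree_like_cuts[OF less.prems(1) that]])
      show "\<forall>Y\<in>bags f. finite (Y - Z) \<and> card (Y - Z) \<le> Suc j"
        using bags_cuts_subset[OF that] less.prems(2) by blast
    qed
    then obtain cf where
      cf_near: "\<And>f x. f \<in> cuts B t \<Longrightarrow> x \<in> near r (bag f - Z) \<Longrightarrow> x \<notin> near \<rho> Z \<Longrightarrow> cf f x = c0f f x" and
      cf_bounded: "\<And>f Q. f \<in> cuts B t \<Longrightarrow> Q \<in> clusters (cf f) r (verts_of f - near \<rho> Z) \<Longrightarrow> bounded_by C Q" and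
      cf_stop: "\<And>f Q. f \<in> cuts B t \<Longrightarrow> Q \<in> clusters (cf f) r (verts_of f - near \<rho> Z) \<Longrightarrow>
        Q \<inter> near r (bag f - Z) \<noteq> {} \<Longrightarrow> Q \<subseteq> near (3 * r) (bag f - Z)"
      by (metis Diff_iff)
    \<comment> \<open>The two rings around \<open>S\<close> get opposite colours. On adhesion sets
      \<open>cH\<close> takes precedence over \<open>cf\<close>. \<open>SOME\<close> picks the only
      cut subtree containing \<open>x\<close>, since distinct ones share vertices only in
      \<open>P\<close>.\<close>
    define c where "c x =
      (if x \<in> near r S then c0 x else if x \<in> near (2 * r) S then True else if x \<in> near (3 * r) S then False
       else if x \<in> P then cH x else cf (SOME f. f \<in> cuts B t \<and> x \<in> verts_of f) x)" for x
    have near23: "x \<in> near (3 * r) S" if "x \<in> near r S \<or> x \<in> near (2 * r) S" for x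
      using that near_mono[of x _ S "3 * r"] pos by auto
    have near12: "x \<in> near (2 * r) S" if "x \<in> near r S" for x
      using that near_mono[of x _ S "2 * r"] pos by auto
    \<comment> \<open>A short route from \<open>x\<close> to \<open>S\<close> passes the adhesion
      set at some \<open>a\<close> close to \<open>S\<close>. As \<open>bag f\<close> misses
      \<open>B\<close>, this \<open>a\<close> is in \<open>Z\<close>, which puts \<open>x\<close>
      too close to the hole.\<close>
    have far_cut: "x \<notin> near (3 * r) S" if f: "f \<in> cuts B t" "x \<in> verts_of f" "x \<notin> near \<rho> Z" for f x
    proof
      assume "x \<in> near (3 * r) S"
      then obtain s where s: "s \<in> S" "D (3 * r) x s" by (auto simp: near_def)
      then obtain a where a: "a \<in> bag f" "D (3 * r) x a" "D (3 * r) a s"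
        using separatesD[OF sep[OF f(1)] f(2), of s] S_P by auto
      then have "a \<in> near (3 * r) S" using s nearI by blast
      then have "a \<in> Z" using bag_cuts[OF f(1)] a by (auto simp: B_def)
      then have "x \<in> near \<rho> Z" using near_mono[OF nearI] a const by blast
      with f show False by blast
    qed
    have c_P: "c x = cH x" if "x \<in> P" "x \<notin> near (3 * r) S" for x
      using that near23 by (auto simp: c_def)
    \<comment> \<open>On the adhesion set both colourings agree because \<open>cf\<close> was
      prescribed there to be \<open>cH\<close>.\<close>
    have c_cut: "c x = cf f x" if f: "f \<in> cuts B t" "x \<in> verts_of f" "x \<notin> near \<rho> Z" for f x
    proof (cases "x \<in> P")
      case True
      then have "x \<in> bag f" using sep[OF f(1)] f(2) by (auto simp: separates_def)
      then have "x \<in> near r (bag f - Z)" using near_self[of r "bag f - Z"] notZ f pos by auto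
      then show ?thesis using cf_near f c_P[OF True far_cut[OF f]] True by (simp add: c0f_def)
    next
      case False
      define g where "g = (SOME f. f \<in> cuts B t \<and> x \<in> verts_of f)"
      have g: "g \<in> cuts B t \<and> x \<in> verts_of g" unfolding g_def by (rule someI) (use f in blast)
      have "g = f" using sep[OF f(1)] f(2) g False by (auto simp: separates_def)
      moreover have "c x = cf g x" using False far_cut[OF f] near23 by (auto simp: c_def g_def)
      ultimately show ?thesis by simp
    qed
    have cluster_cut: "K \<in> clusters (cf f) r (verts_of f - near \<rho> Z)"
      if "f \<in> cuts B t" "K \<subseteq> verts_of f" "K \<in> clusters c r (verts_of t - near \<rho> Z)" for f K
    proof -
      have "c x = cf f x" if "x \<in> K" for x
        using c_cut \<open>f \<in> cuts B t\<close> \<open>K \<subseteq> verts_of f\<close> \<open>K \<in> _\<close> that by (auto simp: clusters_def)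
      then show ?thesis using that by (auto simp: clusters_def)
    qed
    \<comment> \<open>A step of length \<open>r\<close> cannot jump over a ring of width
      \<open>r\<close>, so a cluster escaping from \<open>S\<close> would have points in both
      rings.\<close>
    have stop: "Q \<subseteq> near (3 * r) S"
      if Q: "Q \<in> clusters c r (verts_of t - near \<rho> Z)" "x \<in> Q" "x \<in> near r S" for Q x
    proof (rule ccontr)
      assume "\<not> Q \<subseteq> near (3 * r) S"
      then have n: "\<not> Q \<subseteq> near r S" "\<not> Q \<subseteq> near (2 * r) S" using near23 by blast+
      have rc: "rconn r Q" using Q by (simp add: clusters_def)
      obtain u v where "u \<in> near r S" "v \<in> Q" "v \<notin> near r S" "D r u v"
        using rconn_exit[OF rc Q(2,3) n(1)] by blast
      then have v: "v \<in> Q" "c v" using near_trans[of u r S r v "2 * r"] sym by (auto simp: c_def)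
      obtain u' v' where "u' \<in> near (2 * r) S" "v' \<in> Q" "v' \<notin> near (2 * r) S" "D r u' v'"
        using rconn_exit[OF rc Q(2) near12[OF Q(3)] n(2)] by blast
      then have "v' \<in> Q" "\<not> c v'" using near_trans[of u' "2 * r" S r v' "3 * r"] sym near12 by (auto simp: c_def)
      with v Q(1) show False by (auto simp: clusters_def)
    qed
    have bounded: "bounded_by C Q" if Q: "Q \<in> clusters c r (verts_of t - near \<rho> Z)" for Q
    proof (cases "\<exists>f\<in>cuts B t. Q \<subseteq> verts_of f")
      case True
      then show ?thesis using cluster_cut cf_bounded Q by blast
    next
      case False
      obtain \<kappa> where Q': "Q \<subseteq> verts_of t" "\<And>x. x \<in> Q \<Longrightarrow> x \<notin> near \<rho> Z" "rconn r Q" "\<And>x. x \<in> Q \<Longrightarrow> c x = \<kappa>"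
        using Q by (auto simp: clusters_def)
      \<comment> \<open>A cluster not contained in one cut subtree is moved into the pruned part,
        each point to one whose \<open>cH\<close>-colour is \<kappa> or which is close to
        \<open>S\<close>.\<close>
      have "\<exists>h\<in>P. D (M + r) x h \<and> (cH h = \<kappa> \<or> h \<in> near (3 * r) S)" if x: "x \<in> Q" for x
      proof (cases "x \<in> P")
        case True
        moreover have "D (M + r) x x" using mono[OF refl] const pos by simp
        moreover have "cH x = \<kappa> \<or> x \<in> near (3 * r) S" using c_P[OF True] Q'(4)[OF x] by auto
        ultimately show ?thesis by blast
      next
        case xP: False
        then obtain f where f: "f \<in> cuts B t" "x \<in> verts_of f"
          using verts_prune_cuts[of t B] Q'(1) x by (auto simp: P_def)
        obtain u v where uv: "linked r (Q \<inter> verts_of f) x u" "u \<in> Q" "u \<in> verts_of f"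
          "v \<in> Q" "v \<notin> verts_of f" "D r u v"
          using rconn_exit[OF Q'(3) x f(2)] False f(1) by blast
        \<comment> \<open>The step from \<open>u\<close> to \<open>v\<close> leaves the cut subtree,
          hence passes an adhesion point within \<open>r\<close> of \<open>u\<close>; it is outside
          \<open>Z\<close> because \<open>u\<close> is far from the hole.\<close>
        have "v \<in> P \<union> (\<Union>g\<in>cuts B t - {f}. verts_of g)"
          using verts_prune_cuts[of t B] Q'(1) uv by (auto simp: P_def)
        then obtain a where a: "a \<in> bag f \<inter> P" "D r u a"
          using separatesD[OF sep[OF f(1)] uv(3) _ uv(6)] by blast
        have "a \<notin> Z" using near_mono[OF nearI, of a Z r u \<rho>] a Q'(2)[OF uv(2)] const by blast
        then have u_near: "u \<in> near r (bag f - Z)" using a nearI by blast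
        \<comment> \<open>This piece contains \<open>u\<close>, so \<open>cf_stop\<close> confines
          it to the \<open>3 * r\<close>-neighbourhood of at most \<open>Suc j\<close> vertices, and
          its diameter is at most \<open>M\<close>.\<close>
        define K where "K = {y. linked r (Q \<inter> verts_of f) x y}"
        have K: "K \<in> clusters (cf f) r (verts_of f - near \<rho> Z)"
        proof (rule cluster_cut[OF f(1)])
          show "K \<subseteq> verts_of f" using linked_in x f unfolding K_def by blast
          show "K \<in> clusters c r (verts_of t - near \<rho> Z)"
            unfolding K_def by (rule clusters_component[where \<kappa> = \<kappa>]) (use Q' x f in auto)
        qed
        have "K \<subseteq> near (3 * r) (bag f - Z)"
          using cf_stop[OF f(1) K] u_near uv(1) unfolding K_def by blast
        moreover have "finite (bag f - Z)" "card (bag f - Z) \<le> Suc j"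
          using less.prems(2) bags_cuts_subset[OF f(1)] bag_in_bags[of f] by blast+
        moreover have "rconn r K" using K by (simp add: clusters_def)
        ultimately have "bounded_by (real (Suc j) * (2 * (3 * r) + r)) K"
          using pos by (intro bounded_by_near_finite) auto
        then have xu: "D M x u" using uv(1) linked_refl unfolding bounded_by_def K_def M_def by simp
        show ?thesis
        proof (cases "u \<in> P")
          case True
          then have "cH u = \<kappa>" using c_P far_cut[OF f(1) uv(3)] Q'(2,4) uv(2) by auto
          moreover have "D (M + r) x u" using mono[OF xu] pos by simp
          ultimately show ?thesis using True by blast
        next
          case False
          \<comment> \<open>This is the very point from which \<open>c0f\<close> copied the colour
            of \<open>u\<close>.\<close>
          define h where "h = (SOME a. a \<in> bag f \<inter> P \<and> D r u a)"
          have h: "h \<in> bag f \<inter> P \<and> D r u h" unfolding h_def by (rule someI) (use a in blast)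
          have "cH h = c0f f u" using False by (simp add: c0f_def h_def)
          also have "\<dots> = \<kappa>" using cf_near[OF f(1) u_near] c_cut[OF f(1) uv(3)] Q'(2,4) uv(2) by auto
          finally show ?thesis using h triangle[OF xu] by blast
        qed
      qed
      then obtain \<pi> where \<pi>: "\<And>x. x \<in> Q \<Longrightarrow> \<pi> x \<in> P" "\<And>x. x \<in> Q \<Longrightarrow> D (M + r) x (\<pi> x)"
        "\<And>x. x \<in> Q \<Longrightarrow> cH (\<pi> x) = \<kappa> \<or> \<pi> x \<in> near (3 * r) S"
        by metis
      define Pi where "Pi = \<pi> ` Q"
      have rcPi: "rconn r' Pi" unfolding rconn_def Pi_def
      proof safe
        fix x y assume xy: "x \<in> Q" "y \<in> Q"
        have "linked r Q x y" using Q'(3) xy by (simp add: rconn_def)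
        then show "linked r' (\<pi> ` Q) (\<pi> x) (\<pi> y)"
        proof (rule linked_image)
          fix x y assume "x \<in> Q" "y \<in> Q" "D r x y"
          then have "D ((M + r) + r + (M + r)) (\<pi> x) (\<pi> y)" using \<pi>(2) triangle sym by meson
          then show "D r' (\<pi> x) (\<pi> y)" by (rule mono) (simp add: r'_def)
        qed
      qed
      \<comment> \<open>By the choice of \<open>\<rho>\<close> a shift by \<open>M + r\<close>
        cannot bring a point of \<open>Q\<close> within \<open>\<rho>'\<close> of the hole.\<close>
      have Pi_far: "h \<notin> near \<rho>' Z" if hPi: "h \<in> Pi" for h
      proof
        assume h: "h \<in> near \<rho>' Z"
        obtain x where "x \<in> Q" "h = \<pi> x" using hPi Pi_def by blast
        then have "x \<in> near \<rho> Z" using near_trans[OF h, of "M + r" x \<rho>] \<pi>(2) \<open>h = \<pi> x\<close> by (simp add: \<rho>_def)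
        then show False using Q'(2) \<open>x \<in> Q\<close> by blast
      qed
      have B_near: "near \<rho>' B \<subseteq> near (\<rho>' + 3 * r) S"
      proof
        fix x assume "x \<in> near \<rho>' B"
        then obtain b where "b \<in> near (3 * r) S" "D \<rho>' x b" by (auto simp: near_def B_def)
        then show "x \<in> near (\<rho>' + 3 * r) S" using near_trans by blast
      qed
      \<comment> \<open>Points within \<open>3 * r\<close> of \<open>S\<close> and outside
        \<open>Z\<close> form \<open>B\<close>, so away from \<open>B\<close> only the first
        alternative for \<open>\<pi>\<close> remains.\<close>
      have cH_Pi: "cH h = \<kappa>" if h: "h \<in> Pi" "h \<notin> near \<rho>' B" for h
      proof -
        have "h \<notin> Z" "h \<notin> B" using near_self[OF pos(3)] Pi_far h by blast+
        then have "h \<notin> near (3 * r) S" by (simp add: B_def)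
        then show ?thesis using \<pi>(3) h by (auto simp: Pi_def)
      qed
      have far_un: "Pi - near \<rho>' B \<subseteq> P - near \<rho>' (Z \<union> B)"
        using Pi_far \<pi>(1) by (auto simp: Pi_def near_def)
      \<comment> \<open>Either \<open>Pi\<close> avoids the neighbourhood of \<open>B\<close> and is
        itself a cluster of \<open>cH\<close>, or all of it lies within \<open>L\<close> of the few
        points of \<open>S\<close>.\<close>
      have Pi_bounded: "bounded_by (real (Suc j) * (2 * L + r') + C') Pi"
      proof (cases "Pi \<inter> near \<rho>' B = {}")
        case True
        have "Pi \<subseteq> P - near \<rho>' (Z \<union> B)" "\<forall>h\<in>Pi. cH h = \<kappa>" using True far_un cH_Pi by blast+
        then have "Pi \<in> clusters cH r' (P - near \<rho>' (Z \<union> B))" using rcPi unfolding clusters_def by blast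
        then have "bounded_by C' Pi" by (rule cH)
        then show ?thesis by (rule bounded_by_mono) (use constC in simp)
      next
        case False
        have Pi_near: "h \<in> near L S" if h: "h \<in> Pi" for h
        proof (cases "h \<in> near \<rho>' B")
          case True
          then show ?thesis using B_near near_mono[of h "\<rho>' + 3 * r" S L] pos const by (auto simp: L_def)
        next
          case hB: False
          \<comment> \<open>Until the chain from \<open>h\<close> first comes close to
            \<open>B\<close>, it stays in one inner cluster, of diameter at most
            \<open>C'\<close>.\<close>
          obtain u v where uv: "linked r' (Pi \<inter> - near \<rho>' B) h u" "v \<in> near \<rho>' B" "D r' u v"
            using rconn_exit[OF rcPi h, of "- near \<rho>' B"] hB False by blast
          have "{y. linked r' (Pi \<inter> - near \<rho>' B) h y} \<in> clusters cH r' (P - near \<rho>' (Z \<union> B))"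
            by (rule clusters_component[where \<kappa> = \<kappa>]) (use far_un cH_Pi h hB in auto)
          then have "D C' h u" using cH uv(1) linked_refl unfolding bounded_by_def by blast
          then have "D (C' + r') h v" using uv(3) triangle by blast
          then show ?thesis using near_trans[of v "\<rho>' + 3 * r" S "C' + r'" h L] uv(2) B_near by (auto simp: L_def)
        qed
        then have "bounded_by (real (Suc j) * (2 * L + r')) Pi"
          using finS rcPi const by (intro bounded_by_near_finite[of S]) auto
        then show ?thesis by (rule bounded_by_mono) (use pos in simp)
      qed
      have "D ((M + r) + (real (Suc j) * (2 * L + r') + C') + (M + r)) x y" if "x \<in> Q" "y \<in> Q" for x y
      proof -
        have "D (real (Suc j) * (2 * L + r') + C') (\<pi> x) (\<pi> y)"
          using Pi_bounded that unfolding bounded_by_def Pi_def by blast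
        then show ?thesis by (intro triangle[OF triangle[OF \<pi>(2)] sym[OF \<pi>(2)]] that)
      qed
      then show ?thesis unfolding bounded_by_def C_def by (simp add: algebra_simps)
    qed
    have "(\<forall>x \<in> near r S - near \<rho> Z. c x = c0 x) \<and>
      (\<forall>Q \<in> clusters c r (verts_of t - near \<rho> Z). bounded_by C Q \<and>
         (Q \<inter> near r S \<noteq> {} \<longrightarrow> Q \<subseteq> near (3 * r) S))"
    proof (intro conjI ballI impI)
      fix Q assume Q: "Q \<in> clusters c r (verts_of t - near \<rho> Z)"
      show "bounded_by C Q" using Q by (rule bounded)
      assume "Q \<inter> near r S \<noteq> {}"
      then obtain x where "x \<in> Q" "x \<in> near r S" by blast
      then show "Q \<subseteq> near (3 * r) S" by (rule stop[OF Q])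
    qed (simp add: c_def)
    then show ?case unfolding S_def by (rule exI[of _ c])
  qed
  show ?thesis unfolding controlled_def
  proof (intro allI impI)
    fix t :: "'v rtree" and Z
    assume t: "tree_like t" "\<forall>Y\<in>bags t. finite (Y - Z) \<and> card (Y - Z) \<le> Suc j"
    obtain c where "\<forall>Q \<in> clusters c r (verts_of t - near \<rho> Z). bounded_by C Q \<and>
         (Q \<inter> near r (bag t - Z) \<noteq> {} \<longrightarrow> Q \<subseteq> near (3 * r) (bag t - Z))"
      using ext[OF t, of "\<lambda>_. True"] by (elim exE conjE)
    then show "\<exists>c. \<forall>Q \<in> clusters c r (verts_of t - near \<rho> Z). bounded_by C Q" by (intro exI[of _ c]) simp
  qed
qed

end

text \<open>The constants are chosen before \<open>D\<close>, so one pair serves all spaces on the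
  vertex type. The induction generalises \<open>r\<close> because each step calls the previous level
  at a larger scale.\<close>

lemma controlled_exists:
  fixes r :: real
  assumes "0 < r"
  shows "\<exists>C \<rho>. 0 \<le> C \<and> 0 \<le> \<rho> \<and> (\<forall>D :: real \<Rightarrow> 'v \<Rightarrow> 'v \<Rightarrow> bool. coarse D \<longrightarrow> coarse.controlled D j r C \<rho>)"
  using assms
proof (induction j arbitrary: r)
  case 0
  then show ?case using coarse.controlled_0 by blast
next
  case (Suc j)
  define M where "M = real (Suc j) * (7 * r)"
  have M: "0 \<le> M" using Suc.prems by (simp add: M_def)
  obtain C' \<rho>' where C': "0 \<le> C'" "0 \<le> \<rho>'"
    "\<And>D :: real \<Rightarrow> 'v \<Rightarrow> 'v \<Rightarrow> bool. coarse D \<Longrightarrow> coarse.controlled D j (2 * M + 3 * r) C' \<rho>'"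
    using Suc.IH[of "2 * M + 3 * r"] M Suc.prems by auto
  show ?case
  proof (intro exI conjI allI impI)
    fix D :: "real \<Rightarrow> 'v \<Rightarrow> 'v \<Rightarrow> bool"
    assume "coarse D"
    then show "coarse.controlled D (Suc j) r
      (2 * (M + r) + real (Suc j) * (2 * (C' + (2 * M + 3 * r) + \<rho>' + 3 * r) + (2 * M + 3 * r)) + C')
      (\<rho>' + M + r)"
      using coarse.controlled_Suc[OF \<open>coarse D\<close>, of j r C' \<rho>'] C' Suc.prems by (simp only: M_def)
  qed (use C' M Suc.prems in auto)
qed

section \<open>Rooting a tree-decomposition\<close>

text \<open>The combinatorial counterpart of \<open>tree_like\<close>: the running intersection
  property in rooted form.\<close>

fun coherent :: "'v rtree \<Rightarrow> bool" where
  "coherent (Node X ks) \<longleftrightarrow> (\<forall>k\<in>set ks. coherent k \<and>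
     verts_of k \<inter> (X \<union> (\<Union>k'\<in>set ks - {k}. verts_of k')) \<subseteq> X \<inter> bag k)"

text \<open>The new bag becomes a leaf below a node with bag \<open>Y\<close>. Its vertices already
  present lie in \<open>Y\<close>, so the intersections required along the path to that node
  persist.\<close>

lemma coherent_add_leaf:
  assumes "coherent t" "Y \<in> bags t" "X \<inter> verts_of t \<subseteq> Y"
  shows "\<exists>t'. coherent t' \<and> bags t' = insert X (bags t) \<and> bag t' = bag t"
  using assms
proof (induction t)
  case (Node R ks)
  have split: "verts_of k \<inter> (R \<union> (\<Union>k'\<in>set ks - {k}. verts_of k')) \<subseteq> R \<inter> bag k" "coherent k"
    if "k \<in> set ks" for k
    using Node.prems(1) that by auto
  have sub: "verts_of k \<subseteq> verts_of (Node R ks)" if "k \<in> set ks" for k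
    using that by auto
  show ?case
  proof (cases "Y = R")
    case True
    have "verts_of k \<inter> (R \<union> (\<Union>k'\<in>set (Node X [] # ks) - {k}. verts_of k')) \<subseteq> R \<inter> bag k"
      if "k \<in> set ks" for k
      using split[OF that] sub[OF that] Node.prems(3) True by auto
    moreover have "X \<inter> (R \<union> (\<Union>k'\<in>set ks. verts_of k')) \<subseteq> R"
      using Node.prems(3) True by auto
    ultimately have "coherent (Node R (Node X [] # ks))" using split by auto
    then show ?thesis by (intro exI[of _ "Node R (Node X [] # ks)"]) auto
  next
    case False
    then obtain k where k: "k \<in> set ks" "Y \<in> bags k" using Node.prems(2) by auto
    have Yk: "Y \<subseteq> verts_of k" using k by (auto simp: verts_of_bags)
    obtain k' where k': "coherent k'" "bags k' = insert X (bags k)" "bag k' = bag k"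
      using Node.IH[OF k(1) split(2)[OF k(1)] k(2)] Node.prems(3) sub[OF k(1)] by blast
    have vk': "verts_of k' = X \<union> verts_of k" using k' by (simp add: verts_of_bags)
    \<comment> \<open>All copies of \<open>k\<close> are dropped, since a remaining one would
      overlap \<open>k'\<close> beyond the root bag in general; no bag is lost, as \<open>k'\<close>
      contains those of \<open>k\<close>.\<close>
    define ks' where "ks' = k' # filter (\<lambda>l. l \<noteq> k) ks"
    have X_rest: "X \<inter> (R \<union> (\<Union>l\<in>set ks. verts_of l)) \<subseteq> verts_of k"
      using Node.prems(3) Yk by auto
    have new: "verts_of k' \<inter> (R \<union> (\<Union>l\<in>set ks' - {k'}. verts_of l)) \<subseteq> R \<inter> bag k'"
    proof
      fix x assume x: "x \<in> verts_of k' \<inter> (R \<union> (\<Union>l\<in>set ks' - {k'}. verts_of l))"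
      then have r: "x \<in> R \<union> (\<Union>l\<in>set ks - {k}. verts_of l)" by (auto simp: ks'_def)
      then have "x \<in> verts_of k" using x X_rest by (auto simp: vk')
      then show "x \<in> R \<inter> bag k'" using split(1)[OF k(1)] r k'(3) by blast
    qed
    have old: "verts_of l \<inter> (R \<union> (\<Union>l'\<in>set ks' - {l}. verts_of l')) \<subseteq> R \<inter> bag l"
      if l: "l \<in> set ks" "l \<noteq> k" for l
    proof
      fix x assume x: "x \<in> verts_of l \<inter> (R \<union> (\<Union>l'\<in>set ks' - {l}. verts_of l'))"
      have "x \<in> X \<Longrightarrow> x \<in> verts_of k" using X_rest x l(1) by blast
      then have "x \<in> R \<union> (\<Union>l'\<in>set ks - {l}. verts_of l')" using x l k(1) by (auto simp: ks'_def vk')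
      then show "x \<in> R \<inter> bag l" using split(1)[OF l(1)] x by blast
    qed
    have "coherent (Node R ks')"
      unfolding coherent.simps
    proof
      fix l assume "l \<in> set ks'"
      then consider "l = k'" | "l \<in> set ks" "l \<noteq> k" by (auto simp: ks'_def)
      then show "coherent l \<and> verts_of l \<inter> (R \<union> (\<Union>k'\<in>set ks' - {l}. verts_of k')) \<subseteq> R \<inter> bag l"
      proof cases
        case 1
        then show ?thesis using new k'(1) by simp
      next
        case 2
        then show ?thesis using old[OF 2] split(2)[OF 2(1)] by simp
      qed
    qed
    moreover have "bags (Node R ks') = insert X (bags (Node R ks))"
      using k k'(2) by (auto simp: ks'_def)
    ultimately show ?thesis by (metis rtree.sel(1))
  qed
qed

section \<open>Connectivity in the decomposition tree\<close>

lemma connected_induced_rtrancl_on: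
  assumes "simple_graph T" "connected (with_proj T \<restriction> S)" "a \<in> S" "b \<in> S"
  shows "(a, b) \<in> rtrancl_on S (parcs T)"
proof -
  interpret pair_bidirected_digraph T by fact
  have "(a, b) \<in> rtrancl_on S (arcs_ends (with_proj (mk_symmetric (with_proj T \<restriction> S))))"
    using assms(2-4) by (auto simp: connected_def strongly_connected_def reachable_def)
  \<comment> \<open>\<open>connected\<close> refers to the symmetric closure, which adds no arc
    outside the already symmetric \<open>T\<close>.\<close>
  moreover have "arcs_ends (with_proj (mk_symmetric (with_proj T \<restriction> S))) \<subseteq> parcs T"
    using pair_sym_arcs by (auto simp: parcs_mk_symmetric symmetric_def dest: symD)
  ultimately show ?thesis by (rule rtrancl_on_mono[rotated 2]) auto
qed

text \<open>Otherwise a simple path from \<open>x\<close> to \<open>y\<close> avoiding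
  \<open>i\<close>, closed up through \<open>i\<close>, is a cycle of length at least 3.\<close>

lemma tree_no_detour:
  assumes "is_tree T" "(i, x) \<in> parcs T" "(i, y) \<in> parcs T"
    "(x, y) \<in> rtrancl_on (pverts T - {i}) (parcs T)"
  shows "x = y"
proof (rule ccontr)
  assume "x \<noteq> y"
  have simple: "pair_bidirected_digraph T" and no_cycle: "\<nexists>c. pre_digraph.cycle (with_proj T) c \<and> 3 \<le> length c"
    using assms(1) by (auto simp: is_tree_def)
  interpret pair_bidirected_digraph T by fact
  \<comment> \<open>Deleting \<open>i\<close> turns the restricted reachability into reachability in
    a graph, which provides a simple path.\<close>
  define H where "H = \<lparr>pverts = pverts T - {i}, parcs = parcs T \<inter> (pverts T - {i}) \<times> (pverts T - {i})\<rparr>"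
  interpret H: pair_wf_digraph H by unfold_locales (auto simp: H_def)
  have "(x, y) \<in> rtrancl_on (pverts H) (parcs H)"
    using assms(4)
  proof (induction rule: rtrancl_on_induct)
    case base
    then show ?case by (simp add: H_def)
  next
    case (step y z)
    then have "(y, z) \<in> parcs H" "z \<in> pverts H" by (auto simp: H_def)
    with step.IH show ?case by (rule rtrancl_on_into_rtrancl_on)
  qed
  then have "x \<rightarrow>\<^sup>*\<^bsub>with_proj H\<^esub> y" by (simp add: reachable_def)
  then obtain p where p: "H.apath x p y" using H.reachable_apath by blast
  have pH: "pcas x p y" "set p \<subseteq> parcs H" "distinct (pawalk_verts x p)" "x \<in> pverts H"
    using p by (auto simp: H.apath_def H.awalk_def)
  have "set (pawalk_verts x p) \<subseteq> pverts H"
    using H.awalkI_apath[OF p] H.awalk_verts_in_verts by blast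
  then have i: "i \<notin> set (pawalk_verts x p)" by (auto simp: H_def)
  have "p \<noteq> []" using pH(1) \<open>x \<noteq> y\<close> by auto
  have yi: "(y, i) \<in> parcs T" using pair_sym_arcs assms(3) by (auto simp: symmetric_def dest: symD)
  have "pcas x (p @ [(y, i)]) i \<and> pawalk_verts x (p @ [(y, i)]) = pawalk_verts x p @ [i]"
    using pH(1) by (induction p arbitrary: x) auto
  moreover have "set p \<subseteq> parcs T" using pH(2) by (auto simp: H_def)
  ultimately have "cycle ((i, x) # p @ [(y, i)])"
    unfolding cycle_def awalk_def
    using pH(3) i assms(2) yi in_arcsD1 by (intro exI[of _ i]) auto
  moreover have "3 \<le> length ((i, x) # p @ [(y, i)])" using \<open>p \<noteq> []\<close> by (cases p) auto
  ultimately show False using no_cycle by blast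
qed

text \<open>Only the stretch after the last visit to \<open>v\<close> is kept; the induction starts
  afresh whenever the walk is back at \<open>v\<close>.\<close>

lemma rtrancl_on_first_step:
  assumes "(v, j) \<in> rtrancl_on S r" "v \<noteq> j"
  shows "\<exists>y\<in>S. (v, y) \<in> r \<and> (y, j) \<in> rtrancl_on (S - {v}) r"
proof -
  have "v = j \<or> (\<exists>y\<in>S. (v, y) \<in> r \<and> (y, j) \<in> rtrancl_on (S - {v}) r)"
    using assms(1)
  proof (induction rule: rtrancl_on_induct)
    case (step y z)
    then show ?case by (cases "z = v") (auto intro: rtrancl_on_into_rtrancl_on)
  qed simp
  with assms(2) show ?thesis by blast
qed

text \<open>The rooted tree only has to carry the bags indexed by \<open>N\<close>; it need not have
  the shape of the subtree.\<close>

definition subtree_realized :: "'t pair_pre_digraph \<Rightarrow> ('t \<Rightarrow> 'a set) \<Rightarrow> 't set \<Rightarrow> bool" where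
  "subtree_realized T X N \<longleftrightarrow> finite N \<and> N \<subseteq> pverts T \<and>
     (\<forall>a\<in>N. \<forall>b\<in>N. (a, b) \<in> rtrancl_on N (parcs T)) \<and> (\<exists>t. coherent t \<and> bags t = X ` N)"

text \<open>Let \<open>x\<close> lie in the new bag and in an old bag \<open>X j\<close>. The walk
  from \<open>v\<close> to \<open>j\<close> through bags containing \<open>x\<close> starts at a
  neighbour \<open>y\<close> of \<open>v\<close> that is joined to \<open>u\<close> via
  \<open>j\<close> avoiding \<open>v\<close>; hence \<open>y = u\<close>. So the new bag meets the
  old ones only inside \<open>X u\<close> and can be attached there.\<close>

lemma subtree_realized_insert:
  assumes td: "tree_decomposition G T X" and N: "subtree_realized T X N"
    and uv: "u \<in> N" "(u, v) \<in> parcs T"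
  shows "subtree_realized T X (insert v N)"
proof (cases "v \<in> N")
  case True
  then show ?thesis using N by (simp add: insert_absorb)
next
  case False
  have T: "is_tree T" "simple_graph T" and XG: "\<And>t. t \<in> pverts T \<Longrightarrow> X t \<subseteq> pverts G"
    and conn: "\<And>x. x \<in> pverts G \<Longrightarrow> connected (with_proj T \<restriction> {t \<in> pverts T. x \<in> X t})"
    using td by (auto simp: tree_decomposition_def is_tree_def)
  interpret pair_bidirected_digraph T by fact
  have vu: "(v, u) \<in> parcs T" using pair_sym_arcs uv by (auto simp: symmetric_def dest: symD)
  have v: "v \<in> pverts T" using uv in_arcsD2 by blast
  have N': "finite N" "N \<subseteq> pverts T" "\<And>a b. a \<in> N \<Longrightarrow> b \<in> N \<Longrightarrow> (a, b) \<in> rtrancl_on N (parcs T)"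
    using N by (auto simp: subtree_realized_def)
  obtain t where t: "coherent t" "bags t = X ` N" using N by (auto simp: subtree_realized_def)
  have "X v \<inter> verts_of t \<subseteq> X u"
  proof
    fix x assume "x \<in> X v \<inter> verts_of t"
    then obtain j where j: "x \<in> X v" "j \<in> N" "x \<in> X j" using t(2) by (auto simp: verts_of_bags)
    have vj: "(v, j) \<in> rtrancl_on {t \<in> pverts T. x \<in> X t} (parcs T)"
      by (rule connected_induced_rtrancl_on[OF T(2) conn]) (use j v N' XG[OF v] in auto)
    have "v \<noteq> j" using False j(2) by blast
    with rtrancl_on_first_step[OF vj] obtain y where y: "x \<in> X y" "(v, y) \<in> parcs T"
      "(y, j) \<in> rtrancl_on ({t \<in> pverts T. x \<in> X t} - {v}) (parcs T)"
      by blast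
    have "(y, j) \<in> rtrancl_on (pverts T - {v}) (parcs T)"
      by (rule rtrancl_on_mono[OF _ _ y(3)]) auto
    moreover have "(j, u) \<in> rtrancl_on (pverts T - {v}) (parcs T)"
      by (rule rtrancl_on_mono[OF _ _ N'(3)[OF j(2) uv(1)]]) (use False N' in auto)
    ultimately have "(y, u) \<in> rtrancl_on (pverts T - {v}) (parcs T)" by (rule rtrancl_on_trans)
    then have "y = u" by (rule tree_no_detour[OF T(1) y(2) vu])
    then show "x \<in> X u" using y by simp
  qed
  then obtain t' where t': "coherent t'" "bags t' = insert (X v) (bags t)"
    using coherent_add_leaf[OF t(1), of "X u" "X v"] t(2) uv(1) by auto
  have lift: "(a, b) \<in> rtrancl_on (insert v N) (parcs T)" if "a \<in> N" "b \<in> N" for a b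
    by (rule rtrancl_on_mono[OF _ _ N'(3)[OF that]]) auto
  have "(a, v) \<in> rtrancl_on (insert v N) (parcs T)" if "a \<in> N" for a
    using rtrancl_on_into_rtrancl_on[OF lift[OF that uv(1)] uv(2)] by simp
  moreover have "(v, a) \<in> rtrancl_on (insert v N) (parcs T)" if "a \<in> N" for a
    using converse_rtrancl_on_into_rtrancl_on[OF vu lift[OF uv(1) that]] by simp
  ultimately have "(a, b) \<in> rtrancl_on (insert v N) (parcs T)" if "a \<in> insert v N" "b \<in> insert v N" for a b
    using that lift by auto
  then show ?thesis unfolding subtree_realized_def using N' v t' t(2) by auto
qed

text \<open>Even in an infinite \<open>T\<close>, one node for each vertex and each edge of the
  finite graph suffices; these are joined along walks in \<open>T\<close>, one arc at a
  time.\<close>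

lemma tree_decomposition_coherent:
  assumes td: "tree_decomposition G T X" and fin: "finite (pverts G)" and G: "simple_graph G"
  shows "\<exists>t. coherent t \<and> bags t \<subseteq> X ` pverts T \<and> verts_of t = pverts G \<and>
    (\<forall>(u, v) \<in> parcs G. \<exists>Y\<in>bags t. u \<in> Y \<and> v \<in> Y)"
proof -
  have T: "simple_graph T" "connected (with_proj T)" and XG: "\<And>t. t \<in> pverts T \<Longrightarrow> X t \<subseteq> pverts G"
    and cov: "(\<Union>t \<in> pverts T. X t) = pverts G"
    and edges: "\<And>u v. (u, v) \<in> parcs G \<Longrightarrow> \<exists>t \<in> pverts T. u \<in> X t \<and> v \<in> X t"
    using td by (auto simp: tree_decomposition_def is_tree_def)
  interpret pair_bidirected_digraph T by fact
  interpret G: pair_bidirected_digraph G by fact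
  obtain a where a: "a \<in> pverts T" using T(2) by (auto simp: connected_def strongly_connected_def)
  have "with_proj T \<restriction> pverts T = with_proj T"
    using in_arcsD1 in_arcsD2 by (auto simp: induce_subgraph_def with_proj_def)
  then have reach: "(a, b) \<in> rtrancl_on (pverts T) (parcs T)" if "b \<in> pverts T" for b
    using connected_induced_rtrancl_on[OF T(1), of "pverts T"] T(2) a that by simp
  have extend: "\<exists>N'. subtree_realized T X N' \<and> N \<subseteq> N' \<and> b \<in> N'"
    if "subtree_realized T X N" "a \<in> N" "b \<in> pverts T" for N b
    using reach[OF that(3)]
  proof (induction rule: rtrancl_on_induct)
    case base
    then show ?case using that by blast
  next
    case (step y z)
    then show ?case using subtree_realized_insert[OF td] by (meson insertCI subset_insertI2)
  qed
  have start: "subtree_realized T X {a}"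
    unfolding subtree_realized_def using a by (auto intro!: exI[of _ "Node (X a) []"])
  have finite_extend: "\<exists>N. subtree_realized T X N \<and> a \<in> N \<and> F \<subseteq> N" if "finite F" "F \<subseteq> pverts T" for F
    using that
  proof (induction F rule: finite_induct)
    case empty
    show ?case using start by blast
  next
    case (insert b F)
    then obtain N where "subtree_realized T X N" "a \<in> N" "F \<subseteq> N" by auto
    then show ?case using extend[of N b] insert.prems by blast
  qed
  obtain n where n: "\<And>x. x \<in> pverts G \<Longrightarrow> n x \<in> pverts T \<and> x \<in> X (n x)" using cov by (metis UN_E)
  obtain m where m: "\<And>u v. (u, v) \<in> parcs G \<Longrightarrow> m u v \<in> pverts T \<and> u \<in> X (m u v) \<and> v \<in> X (m u v)"
    using edges by metis
  have "parcs G \<subseteq> pverts G \<times> pverts G" using G.in_arcsD1 G.in_arcsD2 by auto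
  then have "finite (parcs G)" using fin finite_subset by blast
  then have "finite (n ` pverts G \<union> case_prod m ` parcs G)" using fin by simp
  moreover have "n ` pverts G \<union> case_prod m ` parcs G \<subseteq> pverts T" using n m by auto
  ultimately obtain N where N: "subtree_realized T X N" "n ` pverts G \<union> case_prod m ` parcs G \<subseteq> N"
    using finite_extend by meson
  then obtain t where t: "coherent t" "bags t = X ` N" and NT: "N \<subseteq> pverts T"
    by (auto simp: subtree_realized_def)
  have "verts_of t = pverts G"
  proof
    show "verts_of t \<subseteq> pverts G" using t NT XG unfolding verts_of_bags by fastforce
    show "pverts G \<subseteq> verts_of t" using t N n by (fastforce simp: verts_of_bags)
  qed
  moreover have "\<forall>(u, v) \<in> parcs G. \<exists>Y\<in>bags t. u \<in> Y \<and> v \<in> Y"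
  proof clarify
    fix u v assume uv: "(u, v) \<in> parcs G"
    then have "m u v \<in> N" using N(2) by force
    then show "\<exists>Y\<in>bags t. u \<in> Y \<and> v \<in> Y" using m[OF uv] t(2) by blast
  qed
  moreover have "bags t \<subseteq> X ` pverts T" using t(2) NT by auto
  ultimately show ?thesis using t(1) by (intro exI[of _ t] conjI)
qed

section \<open>Weighted graphs\<close>

text \<open>\<open>s\<close> is only an upper bound for the length and vertices may repeat, so walks
  concatenate freely. The base case admits every point of the type, as reflexivity in
  \<open>coarse\<close> requires.\<close>

inductive walk_within :: "('v \<times> 'v) set \<Rightarrow> ('v \<times> 'v \<Rightarrow> real) \<Rightarrow> real \<Rightarrow> 'v \<Rightarrow> 'v \<Rightarrow> bool"
  for E \<phi> where
  base: "0 \<le> s \<Longrightarrow> walk_within E \<phi> s x x"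
| step: "walk_within E \<phi> s x y \<Longrightarrow> (y, z) \<in> E \<Longrightarrow> s + \<phi> (y, z) \<le> t \<Longrightarrow> walk_within E \<phi> t x z"

lemma walk_within_mono: "walk_within E \<phi> s x y \<Longrightarrow> s \<le> t \<Longrightarrow> walk_within E \<phi> t x y"
proof (induction arbitrary: t rule: walk_within.induct)
  case (base s x)
  then show ?case by (intro walk_within.base) simp
next
  case (step s x y z u)
  then show ?case by (intro walk_within.step[of E \<phi> s x y z t]) auto
qed

lemma walk_within_triangle:
  assumes "walk_within E \<phi> t y z" "walk_within E \<phi> s x y"
  shows "walk_within E \<phi> (s + t) x z"
  using assms
proof (induction rule: walk_within.induct)
  case (base t y)
  then show ?case by (auto intro: walk_within_mono)
next
  case (step t y z w u)
  then show ?case by (intro walk_within.step[of E \<phi> "s + t" x z w]) auto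
qed

lemma walk_within_nonneg:
  assumes "walk_within E \<phi> s x y" "\<And>e. e \<in> E \<Longrightarrow> 0 \<le> \<phi> e"
  shows "0 \<le> s"
  using assms(1)
proof (induction rule: walk_within.induct)
  case (step s x y z t)
  then show ?case using assms(2)[of "(y, z)"] by simp
qed

lemma walk_within_sym:
  assumes "walk_within E \<phi> s x y" "\<And>u v. (u, v) \<in> E \<Longrightarrow> (v, u) \<in> E \<and> \<phi> (v, u) = \<phi> (u, v)"
  shows "walk_within E \<phi> s y x"
  using assms(1)
proof (induction rule: walk_within.induct)
  case (base s x)
  then show ?case by (rule walk_within.base)
next
  case (step s x y z t)
  have "walk_within E \<phi> (\<phi> (y, z)) z y"
    by (rule walk_within.step[OF walk_within.base[OF order_refl]]) (use step assms(2) in auto)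
  then have "walk_within E \<phi> (\<phi> (y, z) + s) z x" using step.IH by (intro walk_within_triangle)
  then show ?case using step.hyps(3) by (auto intro: walk_within_mono)
qed

section \<open>Coarse spaces from weighted graphs\<close>

locale positive_weights =
  fixes E :: "('v \<times> 'v) set" and \<phi> :: "'v \<times> 'v \<Rightarrow> real" and r :: real
  assumes weights: "(u, v) \<in> E \<Longrightarrow> 0 < \<phi> (u, v) \<and> (v, u) \<in> E \<and> \<phi> (v, u) = \<phi> (u, v)"
    and r_pos: "0 < r"
begin

text \<open>Lengths are measured in units of \<open>r\<close>, so a bound at one fixed scale becomes
  a bound linear in \<open>r\<close>.\<close>

definition D :: "real \<Rightarrow> 'v \<Rightarrow> 'v \<Rightarrow> bool" where
  "D s = walk_within E \<phi> (s * r)"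

sublocale coarse D
proof
  show "D 0 x x" for x by (simp add: D_def walk_within.base)
  show "D s x y \<Longrightarrow> D s y x" for s x y
    unfolding D_def by (rule walk_within_sym) (use weights in auto)
  show "D s x y \<Longrightarrow> D t y z \<Longrightarrow> D (s + t) x z" for s t x y z
    unfolding D_def using walk_within_triangle by (simp add: distrib_right)
  show "D s x y \<Longrightarrow> s \<le> t \<Longrightarrow> D t x y" for s t x y
    unfolding D_def using r_pos by (auto intro: walk_within_mono)
qed

text \<open>Every edge stays inside \<open>P\<close> or inside \<open>Q\<close>, so the last vertex
  of the walk in \<open>P\<close> is also in \<open>Q\<close> and serves as
  \<open>a\<close>.\<close>

lemma walk_within_crossing:
  assumes "walk_within E \<phi> s p q" "p \<in> P" "P \<inter> Q \<subseteq> A" "E \<subseteq> P \<times> P \<union> Q \<times> Q"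
  shows "q \<in> P \<or> q \<in> Q \<and> (\<exists>a\<in>A. \<exists>s1 s2. s1 + s2 \<le> s \<and> walk_within E \<phi> s1 p a \<and> walk_within E \<phi> s2 a q)"
  using assms(1,2)
proof (induction rule: walk_within.induct)
  case (step s x y z t)
  have IH: "y \<in> P \<or> y \<in> Q \<and> (\<exists>a\<in>A. \<exists>s1 s2. s1 + s2 \<le> s \<and> walk_within E \<phi> s1 x a \<and> walk_within E \<phi> s2 a y)"
    using step by blast
  show ?case
  proof (cases "z \<in> P")
    case False
    then have yz: "y \<in> Q" "z \<in> Q" using step.hyps(2) assms(4) by auto
    have "\<exists>a\<in>A. \<exists>s1 s2. s1 + s2 \<le> s \<and> walk_within E \<phi> s1 x a \<and> walk_within E \<phi> s2 a y"
    proof (cases "y \<in> P")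
      case True
      then have "y \<in> A" using yz assms(3) by blast
      moreover have "walk_within E \<phi> 0 y y" by (simp add: walk_within.base)
      ultimately show ?thesis using step.hyps(1) by (metis add.right_neutral order_refl)
    next
      case False
      then show ?thesis using IH by blast
    qed
    then obtain a s1 s2 where a: "a \<in> A" "s1 + s2 \<le> s" "walk_within E \<phi> s1 x a" "walk_within E \<phi> s2 a y"
      by blast
    have "walk_within E \<phi> (s2 + \<phi> (y, z)) a z" using a(4) step.hyps(2) by (rule walk_within.step) simp
    moreover have "s1 + (s2 + \<phi> (y, z)) \<le> t" using a(2) step.hyps(3) by simp
    ultimately show ?thesis using a yz by blast
  qed simp
qed simp

lemma separates_edges:
  assumes "P \<inter> Q \<subseteq> A" "E \<subseteq> P \<times> P \<union> Q \<times> Q"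
  shows "separates A P Q"
  unfolding separates_def
proof (intro conjI ballI allI impI)
  fix p q s assume p: "p \<in> P" and q: "q \<in> Q" and d: "D s p q"
  have "\<exists>a\<in>A. \<exists>s1 s2. s1 + s2 \<le> s * r \<and> walk_within E \<phi> s1 p a \<and> walk_within E \<phi> s2 a q"
  proof (cases "q \<in> P")
    case True
    then have "q \<in> A" using q assms(1) by blast
    moreover have "walk_within E \<phi> 0 q q" by (simp add: walk_within.base)
    ultimately show ?thesis using d unfolding D_def by (metis add.right_neutral order_refl)
  next
    case False
    then show ?thesis using walk_within_crossing[OF d[unfolded D_def] p assms] by blast
  qed
  then obtain a s1 s2 where a: "a \<in> A" "s1 + s2 \<le> s * r" "walk_within E \<phi> s1 p a" "walk_within E \<phi> s2 a q"
    by blast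
  have "0 \<le> s1" "0 \<le> s2" using a walk_within_nonneg weights by (metis less_imp_le surj_pair)+
  moreover have "s1 / r + s2 / r \<le> s" using a(2) r_pos by (simp add: field_simps)
  moreover have "D (s1 / r) p a" "D (s2 / r) a q" using a r_pos by (auto simp: D_def)
  ultimately show "\<exists>a\<in>A. \<exists>s1 s2. s1 + s2 \<le> s \<and> 0 \<le> s1 \<and> 0 \<le> s2 \<and> D s1 p a \<and> D s2 a q"
    using a(1) r_pos by (metis divide_nonneg_pos)
qed (use assms in auto)

text \<open>The set \<open>U\<close> holds the vertices outside the current subtree, through which walks may detour.\<close>

lemma tree_like_coherent:
  assumes "coherent t" "verts_of t \<inter> U \<subseteq> bag t" "E \<subseteq> U \<times> U \<union> (\<Union>Y\<in>bags t. Y \<times> Y)"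
  shows "tree_like t"
  using assms
proof (induction t arbitrary: U)
  case (Node X ks)
  have "tree_like k \<and> separates (X \<inter> bag k) (verts_of k) (X \<union> (\<Union>k'\<in>set ks - {k}. verts_of k'))"
    if k: "k \<in> set ks" for k
  proof -
    \<comment> \<open>Seen from the child, the outside also contains the root bag and the sibling
      subtrees.\<close>
    define U' where "U' = U \<union> (X \<union> (\<Union>k'\<in>set ks - {k}. verts_of k'))"
    have "verts_of k \<inter> (X \<union> (\<Union>k'\<in>set ks - {k}. verts_of k')) \<subseteq> X \<inter> bag k"
      using Node.prems(1) k by simp
    moreover have "verts_of k \<inter> U \<subseteq> X" using Node.prems(2) k by auto
    ultimately have int: "verts_of k \<inter> U' \<subseteq> X \<inter> bag k" unfolding U'_def by blast
    have E: "E \<subseteq> U' \<times> U' \<union> (\<Union>Y\<in>bags k. Y \<times> Y)"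
    proof
      fix e assume "e \<in> E"
      then consider "e \<in> U \<times> U" | "e \<in> X \<times> X" | k' Y where "k' \<in> set ks" "Y \<in> bags k'" "e \<in> Y \<times> Y"
        using Node.prems(3) by auto
      then show "e \<in> U' \<times> U' \<union> (\<Union>Y\<in>bags k. Y \<times> Y)"
      proof cases
        case 3
        then have "e \<in> verts_of k' \<times> verts_of k'" by (auto simp: verts_of_bags)
        then show ?thesis using 3 by (cases "k' = k") (auto simp: U'_def)
      qed (auto simp: U'_def)
    qed
    have "coherent k" using Node.prems(1) k by simp
    then have "tree_like k" by (rule Node.IH[OF k _ _ E]) (use int in blast)
    moreover have "(\<Union>Y\<in>bags k. Y \<times> Y) \<subseteq> verts_of k \<times> verts_of k" by (auto simp: verts_of_bags)
    then have "E \<subseteq> verts_of k \<times> verts_of k \<union> U' \<times> U'" using E by blast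
    then have "separates (X \<inter> bag k) (verts_of k) U'" by (rule separates_edges[OF int])
    then have "separates (X \<inter> bag k) (verts_of k) (X \<union> (\<Union>k'\<in>set ks - {k}. verts_of k'))"
      by (rule separates_mono) (auto simp: U'_def)
    ultimately show ?thesis by blast
  qed
  then show ?case by simp
qed

end

section \<open>Graph distance versus walks\<close>

lemma graph_dist_less_imp_walk_within:
  assumes G: "simple_graph G" and d: "graph_dist G \<phi> x y < ereal s"
  shows "walk_within (parcs G) \<phi> s x y"
proof -
  interpret pair_bidirected_digraph G by fact
  have "walk_within (parcs G) \<phi> (\<Sum>e\<leftarrow>p. \<phi> e) x y" if "awalk x p y" for p x
    using that
  proof (induction p arbitrary: x)
    case Nil
    then show ?case by (auto simp: awalk_Nil_iff intro: walk_within.base)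
  next
    case (Cons e p)
    then have e: "e \<in> parcs G" "x = fst e" "awalk (snd e) p y" by (auto simp: awalk_Cons_iff)
    have "walk_within (parcs G) \<phi> (\<phi> e) x (snd e)"
      by (rule walk_within.step[OF walk_within.base[OF order_refl]]) (use e in auto)
    then show ?case using walk_within_triangle[OF Cons.IH[OF e(3)]] by simp
  qed
  \<comment> \<open>Strictness supplies a path without the infimum having to be attained.\<close>
  moreover obtain p where "apath x p y" "(\<Sum>e\<leftarrow>p. \<phi> e) < s"
    using d unfolding graph_dist_def INF_less_iff by auto
  ultimately show ?thesis using awalkI_apath walk_within_mono by (meson less_imp_le)
qed

text \<open>A walk becomes a path arc by arc: if the next vertex is already on the path, the path is
  cut back to it, which does not raise a sum of nonnegative weights.\<close>

lemma walk_within_imp_graph_dist_le: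
  assumes G: "weighted_graph G \<phi>" and d: "walk_within (parcs G) \<phi> s x y" and x: "x \<in> pverts G"
  shows "graph_dist G \<phi> x y \<le> ereal s"
proof -
  have simple: "simple_graph G" and pos: "\<And>e. e \<in> parcs G \<Longrightarrow> 0 \<le> \<phi> e"
    using G by (fastforce simp: weighted_graph_def)+
  interpret pair_bidirected_digraph G by fact
  have "\<exists>p. apath x p y \<and> (\<Sum>e\<leftarrow>p. \<phi> e) \<le> s"
    using d x
  proof (induction rule: walk_within.induct)
    case (base s x)
    then show ?case by (intro exI[of _ "[]"]) (simp add: apath_Nil_iff)
  next
    case (step s x y z t)
    then obtain p where p: "apath x p y" "(\<Sum>e\<leftarrow>p. \<phi> e) \<le> s" by blast
    have aw: "awalk x p y" using p(1) by (rule awalkI_apath)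
    have z: "z \<in> pverts G" using step.hyps(2) by (rule in_arcsD2)
    show ?case
    proof (cases "z \<in> set (pawalk_verts x p)")
      case True
      then obtain q q' where q: "p = q @ q'" "awalk x q z" "awalk z q' y"
        using awalk_decomp[OF aw] by blast
      have "last (pawalk_verts x q) = z" using q(2) by simp
      moreover have "apath x q (last (pawalk_verts x q))"
        using p(1) unfolding q(1) apath_append_iff by blast
      ultimately have "apath x q z" by simp
      moreover have "0 \<le> (\<Sum>e\<leftarrow>q'. \<phi> e)"
        using q(3) pos by (intro sum_list_nonneg) (auto simp: awalk_def)
      moreover have "0 \<le> \<phi> (y, z)" using pos step.hyps(2) by blast
      ultimately show ?thesis using p(2) q(1) step.hyps(3) by (intro exI[of _ q]) auto
    next
      case False
      have "last (pawalk_verts x p) = y" using aw by simp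
      moreover have "y \<noteq> z" using pair_no_loops[OF step.hyps(2)] by simp
      ultimately have "apath x (p @ [(y, z)]) z"
        using p(1) step.hyps(2) z False by (simp add: apath_append_iff apath_Cons_iff apath_Nil_iff)
      then show ?thesis using p(2) step.hyps(3) by (intro exI[of _ "p @ [(y, z)]"]) auto
    qed
  qed
  then show ?thesis unfolding graph_dist_def by (auto intro: INF_lower2)
qed

lemma tree_width_le_imp_decomposition:
  fixes G :: "'a pair_pre_digraph"
  assumes G: "simple_graph G" and fin: "finite (pverts G)" and w: "tree_width G \<le> int w"
  shows "\<exists>(T :: nat pair_pre_digraph) X. tree_decomposition G T X \<and> (\<forall>t\<in>pverts T. card (X t) \<le> Suc w)"
proof -
  interpret pair_bidirected_digraph G by fact
  let ?widths = "{td_width T X | (T :: nat pair_pre_digraph) X. tree_decomposition G T X}"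
  \<comment> \<open>A single node carrying all vertices shows that the set of widths is nonempty, so
    that its infimum is meaningful.\<close>
  define T1 :: "nat pair_pre_digraph" where "T1 = \<lparr>pverts = {0}, parcs = {}\<rparr>"
  have simple1: "pair_bidirected_digraph T1"
    by unfold_locales (auto simp: T1_def symmetric_def sym_def)
  interpret T1: pair_bidirected_digraph T1 by fact
  have conn: "connected H" if "verts H = {0}" for H :: "(nat, nat \<times> nat) pre_digraph"
    using that by (auto simp: connected_def strongly_connected_def reachable_def)
  have "parcs T1 = {}" by (simp add: T1_def)
  then have "\<not> T1.cycle c" for c
    by (auto simp: T1.cycle_def T1.awalk_def)
  then have "is_tree T1" using simple1 conn[of "with_proj T1"] by (auto simp: is_tree_def T1_def)
  moreover have "connected (with_proj T1 \<restriction> {0})" by (rule conn) simp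
  ultimately have "tree_decomposition G T1 (\<lambda>_. pverts G)"
    using in_arcsD1 in_arcsD2 by (auto simp: tree_decomposition_def T1_def)
  then have "?widths \<noteq> {}" by blast
  \<comment> \<open>\<open>cInf_lessD\<close> wants a strict bound; for integers, below
    \<open>w + 1\<close> means at most \<open>w\<close>.\<close>
  moreover have "Inf ?widths < int w + 1" using w by (simp add: tree_width_def)
  ultimately have "\<exists>k\<in>?widths. k < int w + 1" by (rule cInf_lessD)
  then obtain T :: "nat pair_pre_digraph" and X where
    TX: "tree_decomposition G T X" "td_width T X < int w + 1"
    by blast
  have "card (X t) \<le> Suc w" if t: "t \<in> pverts T" for t
  proof -
    \<comment> \<open>\<open>T\<close> may be infinite, but the bag sizes are bounded by the number
      of vertices, so the maximum is taken over a finite set.\<close>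
    have "(\<lambda>t. int (card (X t))) ` pverts T \<subseteq> int ` {..card (pverts G)}"
      using TX(1) fin by (auto simp: tree_decomposition_def intro!: imageI card_mono)
    then have "finite ((\<lambda>t. int (card (X t))) ` pverts T)" using finite_subset by blast
    then have "int (card (X t)) \<le> (MAX t\<in>pverts T. int (card (X t)))" using t by (intro Max_ge) auto
    then show ?thesis using TX(2) by (simp add: td_width_def)
  qed
  then show ?thesis using TX(1) by blast
qed

section \<open>Control functions from colourings\<close>

lemma tree_width_control:
  fixes w :: nat
  shows "\<exists>c>0. common_control_function 1
    {(pverts G, graph_dist G \<phi>) | (G :: 'a pair_pre_digraph) \<phi>.
       weighted_graph G \<phi> \<and> finite (pverts G) \<and> tree_width G \<le> int w} (\<lambda>x. c * x)"
proof -
  \<comment> \<open>Width \<open>w\<close> means bags of size at most \<open>Suc w\<close>. Scale 2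
    instead of 1 leaves room between \<open>r\<close> and \<open>2 * r\<close>, since converting a
    distance into a walk needs a strict inequality.\<close>
  obtain C \<rho> :: real where C: "0 \<le> C"
    "\<And>D :: real \<Rightarrow> 'a \<Rightarrow> 'a \<Rightarrow> bool. coarse D \<Longrightarrow> coarse.controlled D (Suc w) 2 C \<rho>"
    using controlled_exists[of 2 "Suc w"] by auto
  have cover: "\<exists>\<U> :: nat \<Rightarrow> 'a set set.
      (\<forall>i \<in> {1..1+1}. \<forall>A \<in> \<U> i. A \<subseteq> pverts G) \<and>
      (\<Union>i \<in> {1..1+1}. \<Union>(\<U> i)) = pverts G \<and>
      (\<forall>i \<in> {1..1+1}. \<forall>A \<in> \<U> i. \<forall>B \<in> \<U> i. A \<noteq> B \<longrightarrow>
         (\<forall>a \<in> A. \<forall>b \<in> B. graph_dist G \<phi> a b > ereal r)) \<and>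
      (\<forall>i \<in> {1..1+1}. \<forall>A \<in> \<U> i. diam (graph_dist G \<phi>) A \<le> ereal ((C + 1) * r))"
    if G: "weighted_graph G \<phi>" "finite (pverts G)" "tree_width G \<le> int w" and r: "0 < r"
    for G :: "'a pair_pre_digraph" and \<phi> r
  proof -
    have simple: "simple_graph G" and wt: "\<And>u v. (u, v) \<in> parcs G \<Longrightarrow> 0 < \<phi> (u, v) \<and> \<phi> (v, u) = \<phi> (u, v)"
      using G(1) by (auto simp: weighted_graph_def)
    interpret G: pair_bidirected_digraph G by fact
    interpret positive_weights "parcs G" \<phi> r
      using wt r G.pair_sym_arcs by unfold_locales (auto simp: symmetric_def dest: symD)
    obtain T :: "nat pair_pre_digraph" and X where
      TX: "tree_decomposition G T X" "\<And>t. t \<in> pverts T \<Longrightarrow> card (X t) \<le> Suc w"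
      using tree_width_le_imp_decomposition[OF simple G(2,3)] by blast
    obtain t where t: "coherent t" "bags t \<subseteq> X ` pverts T" "verts_of t = pverts G"
      "\<forall>(u, v) \<in> parcs G. \<exists>Y\<in>bags t. u \<in> Y \<and> v \<in> Y"
      using tree_decomposition_coherent[OF TX(1) G(2) simple] by blast
    have "tree_like t" by (rule tree_like_coherent[OF t(1), of "{}"]) (use t(4) in auto)
    moreover have "finite (Y - {}) \<and> card (Y - {}) \<le> Suc w" if "Y \<in> bags t" for Y
    proof
      have "Y \<subseteq> pverts G" using that t(3) by (auto simp: verts_of_bags)
      then show "finite (Y - {})" using G(2) finite_subset by auto
      show "card (Y - {}) \<le> Suc w" using that t(2) TX(2) by auto
    qed
    ultimately obtain c where c: "\<And>Q. Q \<in> clusters c 2 (pverts G - near \<rho> {}) \<Longrightarrow> bounded_by C Q"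
      using C(2)[OF coarse_axioms] t(3) unfolding controlled_def by metis
    have near_empty: "near \<rho> {} = {}" by (simp add: near_def)
    \<comment> \<open>Index 1 stands for colour \<open>True\<close> and index 2 for
      \<open>False\<close>; the families consist of the \<open>2 * r\<close>-components of the
      colour classes.\<close>
    define V where "V i = {x \<in> pverts G. c x = (i = 1)}" for i :: nat
    define \<U> where "\<U> i = (\<lambda>x. {y. linked 2 (V i) x y}) ` V i" for i
    have sub: "A \<subseteq> V i" if "A \<in> \<U> i" for A i
      using that linked_in unfolding \<U>_def by blast
    show ?thesis
    proof (intro exI[of _ \<U>] conjI ballI impI)
      show "A \<subseteq> pverts G" if "A \<in> \<U> i" for i A
        using sub[OF that] by (auto simp: V_def)
      show "(\<Union>i \<in> {1..1+1}. \<Union>(\<U> i)) = pverts G"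
      proof
        show "(\<Union>i \<in> {1..1+1}. \<Union>(\<U> i)) \<subseteq> pverts G" using sub by (fastforce simp: V_def)
        show "pverts G \<subseteq> (\<Union>i \<in> {1..1+1}. \<Union>(\<U> i))"
        proof
          fix x assume x: "x \<in> pverts G"
          define i :: nat where "i = (if c x then 1 else 2)"
          have "x \<in> V i" using x by (auto simp: V_def i_def)
          then have "x \<in> \<Union>(\<U> i)" unfolding \<U>_def using linked_refl by blast
          moreover have "i \<in> {1..1+1}" by (auto simp: i_def)
          ultimately show "x \<in> (\<Union>i \<in> {1..1+1}. \<Union>(\<U> i))" by blast
        qed
      qed
      show "graph_dist G \<phi> a b > ereal r" if AB: "A \<in> \<U> i" "B \<in> \<U> i" "A \<noteq> B" "a \<in> A" "b \<in> B" for i A B a b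
      proof (rule ccontr)
        assume "\<not> graph_dist G \<phi> a b > ereal r"
        then have "graph_dist G \<phi> a b \<le> ereal r" by simp
        also have "ereal r < ereal (2 * r)" using r by simp
        finally have "D 2 a b"
          unfolding D_def by (rule graph_dist_less_imp_walk_within[OF simple])
        moreover have "a \<in> V i" "b \<in> V i" using AB sub by blast+
        ultimately have ab: "linked 2 (V i) a b" by (rule linked_step[rotated 2])
        obtain x y where xy: "A = {z. linked 2 (V i) x z}" "B = {z. linked 2 (V i) y z}"
          using AB(1,2) by (auto simp: \<U>_def)
        then have "linked 2 (V i) x y" using AB(4,5) ab linked_trans linked_sym by blast
        then have "A = B" unfolding xy using linked_trans linked_sym by blast
        with AB(3) show False by simp
      qed
      show "diam (graph_dist G \<phi>) A \<le> ereal ((C + 1) * r)" if A: "A \<in> \<U> i" for i A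
      proof -
        obtain x where x: "x \<in> V i" "A = {y. linked 2 (V i) x y}" using A by (auto simp: \<U>_def)
        have "A \<in> clusters c 2 (pverts G - near \<rho> {})"
          unfolding x(2) by (rule clusters_component[where \<kappa> = "i = 1"]) (use x(1) in \<open>auto simp: V_def near_empty\<close>)
        then have bd: "bounded_by C A" by (rule c)
        have "graph_dist G \<phi> a b \<le> ereal ((C + 1) * r)" if ab: "a \<in> A" "b \<in> A" for a b
        proof -
          have "walk_within (parcs G) \<phi> (C * r) a b" using bd ab unfolding bounded_by_def D_def by blast
          then have "walk_within (parcs G) \<phi> ((C + 1) * r) a b"
            by (rule walk_within_mono) (use r in \<open>simp add: distrib_right\<close>)
          moreover have "a \<in> pverts G" using sub[OF A] ab(1) by (auto simp: V_def)
          ultimately show ?thesis by (rule walk_within_imp_graph_dist_le[OF G(1)])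
        qed
        then show ?thesis unfolding diam_def by (intro SUP_least)
      qed
    qed
  qed
  \<comment> \<open>\<open>C\<close> may be 0, whereas a control function must be positive; hence
    the slope \<open>C + 1\<close>.\<close>
  have "0 < C + 1" using C(1) by simp
  then show ?thesis
    unfolding common_control_function_def using cover by (intro exI[of _ "C + 1"]) auto
qed

theorem theorem1p6:
  fixes w :: nat
  assumes "w > 0"
  shows "assouad_nagata_dim
    {(pverts G, graph_dist G \<phi>) | (G :: 'a pair_pre_digraph) \<phi>.
       weighted_graph G \<phi> \<and> finite (pverts G) \<and> tree_width G \<le> int w} \<le> 1"
proof -
  obtain c where "0 < c" "common_control_function 1
    {(pverts G, graph_dist G \<phi>) | (G :: 'a pair_pre_digraph) \<phi>.
       weighted_graph G \<phi> \<and> finite (pverts G) \<and> tree_width G \<le> int w} (\<lambda>x. c * x)"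
    using tree_width_control[of w] by blast
  then show ?thesis
    unfolding assouad_nagata_dim_def one_enat_def by (intro Inf_lower) auto
qed

end
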